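(* Let $X_1,X_2$ be Polish spaces, $a_i:X_i\to[0,+\infty]$ Borel measurable ($i=1,2$), and $c:X_1\times X_2\to[0,+\infty]$ continuous with $c(x_1,x_2)\le a_1(x_1)+a_2(x_2)$ for all $(x_1,x_2)$. Let $\phi_1:\mathcal P_{a_1}(X_1)\to[-\infty,+\infty)$ be not identically $-\infty$. Then: 1. $\widehat{\phi_1^{\mathsf C}}=\hat\phi_1^{\,\hat{\mathsf C}}$; 2. $\phi_1$ is $\mathsf C$-concave if and only if $\hat\phi_1$ is $\hat{\mathsf C}$-concave; 3. $(Z_1,Z_2)\in\partial^+_{\hat{\mathsf C}}\hat\phi_1$ if and only if $(\iota_1(Z_1),\iota_2(Z_2))\in\partial^+_{\mathsf C}\phi_1$ and $\hat{\mathsf C}(Z_1,Z_2)=\mathsf C(\iota_1(Z_1),\iota_2(Z_2))$; 4. a set $F\subset\mathcal P_{a_1\oplus a_2}(X_1\times X_2)$ is totally $\mathsf C$-cyclically monotone if and only if $\hat F$ is $\hat{\mathsf C}$-cyclically monotone; 5. $\widehat{\partial^+_{\mathsf t,\mathsf C}\phi_1}=\partial^+_{\hat{\mathsf C}}\hat\phi_1$, that is, $(Z_1,Z_2)\in\partial^+_{\hat{\mathsf C}}\hat\phi_1$ if and only if $(Z_1,Z_2)_\sharp\mathbb M\in\partial^+_{\mathsf t,\mathsf C}\phi_1$.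
   Context: $\mathcal P(Y)$ is the set of Borel probability measures on a Polish space $Y$; $\Gamma(\mu_1,\mu_2)$ is the set of couplings; $\mathsf C(\mu_1,\mu_2):=\min_{\pi\in\Gamma(\mu_1,\mu_2)}\int c\,d\pi$. $\mathcal P_{a_i}(X_i):=\{\mu_i\in\mathcal P(X_i):\int a_i\,d\mu_i<+\infty\}$, $\mathcal P_{a_1\oplus a_2}(X_1\times X_2):=\{\pi:\mathrm{pr}^i_\sharp\pi\in\mathcal P_{a_i}(X_i),\,i=1,2\}$. Lifting: $(Q,\mathcal F_Q,\mathbb M)$ is a fixed atomless standard Borel probability space; $\mathcal X_i:=L^0(Q,\mathcal F_Q,\mathbb M;X_i)$ is the space of measurable maps $Q\to X_i$ modulo $\mathbb M$-a.e. equality; $\iota_i(Z_i):=(Z_i)_\sharp\mathbb M$, $\iota_{1,2}(Z_1,Z_2):=(Z_1,Z_2)_\sharp\mathbb M$; $\hat{\mathsf C}(Z_1,Z_2):=\int_Qc(Z_1,Z_2)\,d\mathbb M$; $\mathcal X_{i,a_i}:=\{Z_i\in\mathcal X_i:\int_Qa_i(Z_i)\,d\mathbb M<+\infty\}$. For $\phi_i:\mathcal P_{a_i}(X_i)\to[-\infty,+\infty]$, $\hat\phi_i:=\phi_i\circ\iota_i:\mathcal X_{i,a_i}\to[-\infty,+\infty]$. For $F\subset\mathcal P(X_1\times X_2)$, $\hat F:=\{(Z_1,Z_2)\in\mathcal X_1\times\mathcal X_2:\iota_{1,2}(Z_1,Z_2)\in F\}$. General notions, for sets $Y_1,Y_2$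 and $D:Y_1\times Y_2\to[0,+\infty)$ (used with $D=\mathsf C$ on $\mathcal P_{a_1}(X_1)\times\mathcal P_{a_2}(X_2)$ and with $D=\hat{\mathsf C}$ on $\mathcal X_{1,a_1}\times\mathcal X_{2,a_2}$, where both are finite): - $G\subset Y_1\times Y_2$ is $D$-cyclically monotone if $\sum_{i\le k}D(y_{1,i},y_{2,\sigma(i)})\ge\sum_{i\le k}D(y_{1,i},y_{2,i})$ for all $k\ge1$, $(y_{1,i},y_{2,i})\in G$ and permutations $\sigma$ of $\{1,\dots,k\}$. - $\phi:Y_1\to[-\infty,+\infty)$ is $D$-concave if it is not identically $-\infty$ and $\phi(y_1)=\inf_{(y_2,\alpha)\in A}D(y_1,y_2)-\alpha$ for some $A\subset Y_2\times\mathbb R$. - The $D$-conjugate is $\phi^D(y_2):=\inf_{y_1\in Y_1}D(y_1,y_2)-\phi(y_1)$. - $\partial^+_D\phi:=\{(y_1,y_2):\phi(y_1)>-\infty,\ D(y_1,y_2)-\phi(y_1)\le D(y_1',y_2)-\phi(y_1')\ \forall y_1'\in Y_1\}$. Total $\mathsf C$-superdifferential: $\partial^+_{\mathsf t,\mathsf C}\phi_1$ is the set of $\pi\in\mathcal P_{a_1\oplus a_2}(X_1\times X_2)$ such that for all $\theta\in\mathcal P(X_1\times X_2\times X_1)$ with $(\mathrm{pr}^1,\mathrm{pr}^2)_\sharp\theta=\pi$ and $\mathrm{pr}^3_\sharp\theta\in\mathcal P_{a_1}(X_1)$, $$\int\big(c(x_1,x_2)-c(x_1',x_2)\big)\,d\theta(x_1,x_2,x_1')\le\phi_1(\mathrm{pr}^1_\sharp\theta)-\phi_1(\mathrm{pr}^3_\sharp\theta).$$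 Total $\mathsf C$-cyclical monotonicity: $F\subset\mathcal P_{a_1\oplus a_2}(X_1\times X_2)$ is totally $\mathsf C$-cyclically monotone if for all $N\ge1$, all $\theta\in\mathcal P((X_1\times X_2)^N)$ whose marginal $\mathrm{pr}^n_\sharp\theta$ on the $n$-th factor $X_1\times X_2$ belongs to $F$ for every $n\le N$, and all permutations $\sigma$ of $\{1,\dots,N\}$, $\int\sum_ic(x_{1,i},x_{2,i})\,d\theta\le\int\sum_ic(x_{1,i},x_{2,\sigma(i)})\,d\theta$. *)

theory Defs
  imports "HOL-Probability.Probability"
begin

section \<open>Cyclical monotonicity, concavity, conjugates and superdifferentials for a general cost\<close>

text \<open>
  Here \<open>Y1\<close>, \<open>Y2\<close> are sets and the cost \<open>D\<close> is only evaluated on \<open>Y1 \<times> Y2\<close>, where it is meant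
  to be finite. Functions \<open>Y1 \<rightarrow> [-\<infinity>, +\<infinity>]\<close> are total functions whose values outside \<open>Y1\<close> are
  irrelevant. Since \<open>D\<close> is finite, no difference below is of the form \<open>\<infinity> - \<infinity>\<close> when \<open>\<phi> < +\<infinity>\<close>.
\<close>

definition cyclically_monotone ::
  "'y1 set \<Rightarrow> 'y2 set \<Rightarrow> ('y1 \<Rightarrow> 'y2 \<Rightarrow> ennreal) \<Rightarrow> ('y1 \<times> 'y2) set \<Rightarrow> bool" where
  "cyclically_monotone Y1 Y2 D G \<longleftrightarrow> G \<subseteq> Y1 \<times> Y2 \<and>
     (\<forall>k\<ge>1. \<forall>(y1 :: nat \<Rightarrow> 'y1) (y2 :: nat \<Rightarrow> 'y2) \<sigma>.
        (\<forall>i\<in>{1..k}. (y1 i, y2 i) \<in> G) \<longrightarrow> \<sigma> permutes {1..k} \<longrightarrow>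
        (\<Sum>i=1..k. D (y1 i) (y2 (\<sigma> i))) \<ge> (\<Sum>i=1..k. D (y1 i) (y2 i)))"

definition cost_concave ::
  "'y1 set \<Rightarrow> 'y2 set \<Rightarrow> ('y1 \<Rightarrow> 'y2 \<Rightarrow> ennreal) \<Rightarrow> ('y1 \<Rightarrow> ereal) \<Rightarrow> bool" where
  "cost_concave Y1 Y2 D \<phi> \<longleftrightarrow>
     (\<forall>y1\<in>Y1. \<phi> y1 < \<infinity>) \<and> (\<exists>y1\<in>Y1. \<phi> y1 \<noteq> -\<infinity>) \<and>
     (\<exists>A \<subseteq> Y2 \<times> (UNIV :: real set). \<forall>y1\<in>Y1.
        \<phi> y1 = (INF (y2, \<alpha>)\<in>A. enn2ereal (D y1 y2) - ereal \<alpha>))"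

definition cost_conjugate ::
  "'y1 set \<Rightarrow> ('y1 \<Rightarrow> 'y2 \<Rightarrow> ennreal) \<Rightarrow> ('y1 \<Rightarrow> ereal) \<Rightarrow> 'y2 \<Rightarrow> ereal" where
  "cost_conjugate Y1 D \<phi> y2 = (INF y1\<in>Y1. enn2ereal (D y1 y2) - \<phi> y1)"

definition superdifferential ::
  "'y1 set \<Rightarrow> 'y2 set \<Rightarrow> ('y1 \<Rightarrow> 'y2 \<Rightarrow> ennreal) \<Rightarrow> ('y1 \<Rightarrow> ereal) \<Rightarrow> ('y1 \<times> 'y2) set" where
  "superdifferential Y1 Y2 D \<phi> = {(y1, y2) \<in> Y1 \<times> Y2. \<phi> y1 > -\<infinity> \<and>
     (\<forall>y1'\<in>Y1. enn2ereal (D y1 y2) - \<phi> y1 \<le> enn2ereal (D y1' y2) - \<phi> y1')}"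


section \<open>Probability measures, couplings and the transport cost\<close>

definition Prob :: "'a::topological_space measure set" where
  "Prob = space (prob_algebra borel)"

definition Prob_fin :: "('a::topological_space \<Rightarrow> ennreal) \<Rightarrow> 'a measure set" where
  "Prob_fin a = {\<mu> \<in> Prob. (\<integral>\<^sup>+x. a x \<partial>\<mu>) < \<infinity>}"

definition Prob_fin2 ::
  "('a::topological_space \<Rightarrow> ennreal) \<Rightarrow> ('b::topological_space \<Rightarrow> ennreal) \<Rightarrow> ('a \<times> 'b) measure set" where
  "Prob_fin2 a1 a2 = {\<pi> \<in> Prob. distr \<pi> borel fst \<in> Prob_fin a1 \<and> distr \<pi> borel snd \<in> Prob_fin a2}"

definition couplings ::
  "'a::topological_space measure \<Rightarrow> 'b::topological_space measure \<Rightarrow> ('a \<times> 'b) measure set" where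
  "couplings \<mu>1 \<mu>2 = {\<pi> \<in> Prob. distr \<pi> borel fst = \<mu>1 \<and> distr \<pi> borel snd = \<mu>2}"

text \<open>For a continuous nonnegative cost on Polish spaces the infimum is a minimum.\<close>

definition transport_cost ::
  "('a::topological_space \<times> 'b::topological_space \<Rightarrow> ennreal) \<Rightarrow> 'a measure \<Rightarrow> 'b measure \<Rightarrow> ennreal" where
  "transport_cost c \<mu>1 \<mu>2 = (INF \<pi>\<in>couplings \<mu>1 \<mu>2. \<integral>\<^sup>+x. c x \<partial>\<pi>)"


section \<open>Total superdifferential and total cyclical monotonicity\<close>

text \<open>
  For the \<open>\<theta>\<close> considered, \<open>c (x1, x2)\<close> and \<open>c (x1', x2)\<close> are finite almost everywhere and
  integrable when \<open>c \<le> a1 \<oplus> a2\<close>, so the truncation by \<open>enn2real\<close> only acts on a null set.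
  The only indeterminate form on the right-hand side is \<open>-\<infinity> - (-\<infinity>)\<close>. Its value does not matter:
  if \<open>\<phi> (pr1 \<theta>) = -\<infinity>\<close>, then a \<open>\<theta>\<close> whose third marginal has \<open>\<phi> > -\<infinity>\<close> violates the inequality.
\<close>

definition total_superdifferential ::
  "('a::topological_space \<Rightarrow> ennreal) \<Rightarrow> ('b::topological_space \<Rightarrow> ennreal) \<Rightarrow> ('a \<times> 'b \<Rightarrow> ennreal) \<Rightarrow>
   ('a measure \<Rightarrow> ereal) \<Rightarrow> ('a \<times> 'b) measure set" where
  "total_superdifferential a1 a2 c \<phi> = {\<pi> \<in> Prob_fin2 a1 a2.
     \<forall>\<theta> \<in> (Prob :: ('a \<times> 'b \<times> 'a) measure set).
       distr \<theta> borel (\<lambda>(x1, x2, x1'). (x1, x2)) = \<pi> \<longrightarrow>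
       distr \<theta> borel (\<lambda>(x1, x2, x1'). x1') \<in> Prob_fin a1 \<longrightarrow>
       ereal (\<integral>(x1, x2, x1'). enn2real (c (x1, x2)) - enn2real (c (x1', x2)) \<partial>\<theta>)
         \<le> \<phi> (distr \<theta> borel (\<lambda>(x1, x2, x1'). x1)) - \<phi> (distr \<theta> borel (\<lambda>(x1, x2, x1'). x1'))}"

text \<open>
  \<open>(X1 \<times> X2)\<^sup>N\<close> is the extensional product over \<open>{1..N}\<close>; for Polish factors the product
  \<open>\<sigma>\<close>-algebra is the Borel \<open>\<sigma>\<close>-algebra of the product topology.
\<close>

definition totally_cyclically_monotone ::
  "('a::topological_space \<Rightarrow> ennreal) \<Rightarrow> ('b::topological_space \<Rightarrow> ennreal) \<Rightarrow> ('a \<times> 'b \<Rightarrow> ennreal) \<Rightarrow>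
   ('a \<times> 'b) measure set \<Rightarrow> bool" where
  "totally_cyclically_monotone a1 a2 c F \<longleftrightarrow> F \<subseteq> Prob_fin2 a1 a2 \<and>
     (\<forall>N\<ge>1. \<forall>\<theta> \<in> space (prob_algebra (\<Pi>\<^sub>M n\<in>{1..N::nat}. (borel :: ('a \<times> 'b) measure))). \<forall>\<sigma>.
        (\<forall>n\<in>{1..N}. distr \<theta> borel (\<lambda>x. x n) \<in> F) \<longrightarrow> \<sigma> permutes {1..N} \<longrightarrow>
        (\<integral>\<^sup>+x. (\<Sum>i=1..N. c (fst (x i), snd (x i))) \<partial>\<theta>)
          \<le> (\<integral>\<^sup>+x. (\<Sum>i=1..N. c (fst (x i), snd (x (\<sigma> i)))) \<partial>\<theta>))"


section \<open>The lifting\<close>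

definition standard_borel :: "'q measure \<Rightarrow> bool" where
  "standard_borel M \<longleftrightarrow> (\<exists>T. topspace T = space M \<and> completely_metrizable_space T \<and>
     second_countable T \<and> sets M = sigma_sets (space M) {U. openin T U})"

definition atomless :: "'q measure \<Rightarrow> bool" where
  "atomless M \<longleftrightarrow> \<not> (\<exists>A\<in>sets M. emeasure M A > 0 \<and>
     (\<forall>B\<in>sets M. B \<subseteq> A \<longrightarrow> emeasure M B = 0 \<or> emeasure M B = emeasure M A))"

definition ae_eq :: "'q measure \<Rightarrow> (('q \<Rightarrow> 'a::topological_space) \<times> ('q \<Rightarrow> 'a)) set" where
  "ae_eq M = {(f, g). f \<in> M \<rightarrow>\<^sub>M borel \<and> g \<in> M \<rightarrow>\<^sub>M borel \<and> (AE q in M. f q = g q)}"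

text \<open>Elements of \<open>L0 M\<close> are equivalence classes, hence sets of functions.\<close>

definition L0 :: "'q measure \<Rightarrow> ('q \<Rightarrow> 'a::topological_space) set set" where
  "L0 M = (M \<rightarrow>\<^sub>M borel) // ae_eq M"

text \<open>
  Functionals on \<open>L0 M\<close> are evaluated on an arbitrary representative; the lemmas at the end of
  this theory show that the choice is immaterial.
\<close>

definition rep :: "('q \<Rightarrow> 'a) set \<Rightarrow> 'q \<Rightarrow> 'a" where
  "rep Z = (SOME f. f \<in> Z)"

definition L0_fin :: "'q measure \<Rightarrow> ('a::topological_space \<Rightarrow> ennreal) \<Rightarrow> ('q \<Rightarrow> 'a) set set" where
  "L0_fin M a = {Z \<in> L0 M. (\<integral>\<^sup>+q. a (rep Z q) \<partial>M) < \<infinity>}"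

definition law :: "'q measure \<Rightarrow> ('q \<Rightarrow> 'a::topological_space) set \<Rightarrow> 'a measure" where
  "law M Z = distr M borel (rep Z)"

definition joint_law :: "'q measure \<Rightarrow> ('q \<Rightarrow> 'a::topological_space) set \<Rightarrow>
    ('q \<Rightarrow> 'b::topological_space) set \<Rightarrow> ('a \<times> 'b) measure" where
  "joint_law M Z1 Z2 = distr M borel (\<lambda>q. (rep Z1 q, rep Z2 q))"

definition lifted_cost :: "'q measure \<Rightarrow> ('a::topological_space \<times> 'b::topological_space \<Rightarrow> ennreal) \<Rightarrow>
    ('q \<Rightarrow> 'a) set \<Rightarrow> ('q \<Rightarrow> 'b) set \<Rightarrow> ennreal" where
  "lifted_cost M c Z1 Z2 = (\<integral>\<^sup>+q. c (rep Z1 q, rep Z2 q) \<partial>M)"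

definition lift_fun :: "'q measure \<Rightarrow> ('a::topological_space measure \<Rightarrow> ereal) \<Rightarrow>
    ('q \<Rightarrow> 'a) set \<Rightarrow> ereal" where
  "lift_fun M \<phi> = \<phi> \<circ> law M"

definition lift_set :: "'q measure \<Rightarrow> ('a::topological_space \<times> 'b::topological_space) measure set \<Rightarrow>
    (('q \<Rightarrow> 'a) set \<times> ('q \<Rightarrow> 'b) set) set" where
  "lift_set M F = {(Z1, Z2) \<in> L0 M \<times> L0 M. joint_law M Z1 Z2 \<in> F}"


subsection \<open>Independence of the representative\<close>

lemma equiv_ae_eq: "equiv (M \<rightarrow>\<^sub>M borel) (ae_eq M)"
  by (rule equivI) (auto simp: ae_eq_def refl_on_def sym_def trans_def elim: eventually_elim2 eventually_mono)

lemma rep_in: "Z \<in> L0 M \<Longrightarrow> rep Z \<in> Z"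
  unfolding rep_def L0_def using in_quotient_imp_non_empty[OF equiv_ae_eq] some_in_eq by blast

lemma L0_measurable: "Z \<in> L0 M \<Longrightarrow> f \<in> Z \<Longrightarrow> f \<in> M \<rightarrow>\<^sub>M borel"
  unfolding L0_def using in_quotient_imp_subset[OF equiv_ae_eq] by blast

lemma AE_rep: "Z \<in> L0 M \<Longrightarrow> f \<in> Z \<Longrightarrow> AE q in M. rep Z q = f q"
  using in_quotient_imp_in_rel[OF equiv_ae_eq, of Z M "rep Z" f] rep_in[of Z M]
  by (auto simp: L0_def ae_eq_def)

lemma class_in_L0: "f \<in> M \<rightarrow>\<^sub>M borel \<Longrightarrow> ae_eq M `` {f} \<in> L0 M \<and> f \<in> ae_eq M `` {f}"
proof -
  assume f: "f \<in> M \<rightarrow>\<^sub>M borel"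
  show ?thesis
    unfolding L0_def using quotientI[OF f] equiv_class_self[OF equiv_ae_eq f] by blast
qed

lemma law_eq:
  assumes "Z \<in> L0 M" "f \<in> Z"
  shows "law M Z = distr M borel f"
  unfolding law_def
  by (intro distr_cong_AE AE_rep[OF assms] refl L0_measurable[OF assms(1)] rep_in[OF assms(1)] assms(2))

lemma joint_law_eq:
  fixes Z1 :: "('q \<Rightarrow> 'a::second_countable_topology) set" and Z2 :: "('q \<Rightarrow> 'b::second_countable_topology) set"
  assumes "Z1 \<in> L0 M" "f \<in> Z1" "Z2 \<in> L0 M" "g \<in> Z2"
  shows "joint_law M Z1 Z2 = distr M borel (\<lambda>q. (f q, g q))"
proof -
  have [measurable]: "f \<in> M \<rightarrow>\<^sub>M borel" "g \<in> M \<rightarrow>\<^sub>M borel" "rep Z1 \<in> M \<rightarrow>\<^sub>M borel" "rep Z2 \<in> M \<rightarrow>\<^sub>M borel"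
    using assms L0_measurable rep_in by blast+
  have "AE q in M. (rep Z1 q, rep Z2 q) = (f q, g q)"
    using AE_rep[OF assms(1,2)] AE_rep[OF assms(3,4)] by eventually_elim simp
  then show ?thesis
    unfolding joint_law_def by (intro distr_cong_AE) (auto simp flip: borel_prod)
qed

lemma lifted_cost_eq:
  assumes "Z1 \<in> L0 M" "f \<in> Z1" "Z2 \<in> L0 M" "g \<in> Z2"
  shows "lifted_cost M c Z1 Z2 = (\<integral>\<^sup>+q. c (f q, g q) \<partial>M)"
  unfolding lifted_cost_def
proof (rule nn_integral_cong_AE)
  show "AE q in M. c (rep Z1 q, rep Z2 q) = c (f q, g q)"
    using AE_rep[OF assms(1,2)] AE_rep[OF assms(3,4)] by eventually_elim simp
qed

lemma L0_fin_iff: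
  assumes "Z \<in> L0 M" "f \<in> Z"
  shows "Z \<in> L0_fin M a \<longleftrightarrow> (\<integral>\<^sup>+q. a (f q) \<partial>M) < \<infinity>"
proof -
  have "(\<integral>\<^sup>+q. a (rep Z q) \<partial>M) = (\<integral>\<^sup>+q. a (f q) \<partial>M)"
  proof (rule nn_integral_cong_AE)
    show "AE q in M. a (rep Z q) = a (f q)"
      using AE_rep[OF assms] by eventually_elim simp
  qed
  with assms(1) show ?thesis by (simp add: L0_fin_def)
qed

end

theory Submission
  imports Defs
begin

text \<open>
  Everything reduces to one fact: if \<open>Z2\<close> is fixed and \<open>Z1\<close> ranges over the random variables of
  law \<open>\<mu>\<close>, then the infimum of the lifted costs of \<open>(Z1, Z2)\<close> is the transport cost between \<open>\<mu>\<close>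
  and the law of \<open>Z2\<close>, and symmetrically. For a coupling \<open>\<pi>\<close>, cut the second factor into countably
  many small cells and realise \<open>\<pi>\<close> by a pair \<open>(Z1, Z2')\<close> such that \<open>Z2'\<close> always lies in the cell of
  \<open>Z2\<close>; this is possible because \<open>M\<close> has no atoms on the sets where \<open>Z2\<close> lies in a given cell. The
  cost of \<open>(Z1, Z2)\<close> is at most the \<open>\<pi>\<close>-integral of the supremum of \<open>c\<close> over cells, which tends to
  \<open>\<integral>c d\<pi>\<close> as the cells shrink. Domination comes for free if \<open>a2\<close> varies by at most \<open>1\<close> on each
  cell.

  For the total notions, a measure on a product is realised on the probability space, and only the
  coupling of the third and second marginals of \<open>\<theta>\<close> matters in the total superdifferential.
\<close>

section \<open>Encoding by reals\<close>

text \<open>A Cantor-type encoding with digits 0 and 1 in base 3: a missing digit cannot be made up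
  for by all later ones together, so the sum determines membership in every \<open>U n\<close>. In
  base 2 two digit sequences could share one sum.\<close>

definition code :: "(nat \<Rightarrow> 'x set) \<Rightarrow> 'x \<Rightarrow> real" where
  "code U x = (\<Sum>n. if x \<in> U n then (1/3)^n else 0)"

lemma code_summable: "summable (\<lambda>n. if x \<in> U n then (1/3)^n else (0::real))"
  by (rule summable_comparison_test'[of "\<lambda>n. (1/3)^n" 0]) auto

lemma code_measurable:
  assumes "\<And>n. U n \<in> sets M"
  shows "code U \<in> borel_measurable M"
proof -
  have [measurable]: "\<And>n. U n \<in> sets M" by fact
  show ?thesis unfolding code_def by measurable
qed

text \<open>Greedy expansion: the tail after the \<open>n\<close>-th digit is at most half of \<open>3\<^sup>-\<^sup>n\<close>, so the
  digits can be read off.\<close>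

primrec greedy :: "nat \<Rightarrow> real \<Rightarrow> real" where
  "greedy 0 r = 0"
| "greedy (Suc n) r = greedy n r + (if (1/3)^n \<le> r - greedy n r then (1/3)^n else 0)"

lemma greedy_measurable [measurable]: "greedy n \<in> borel_measurable borel"
  by (induction n) auto

lemma code_digit:
  assumes "greedy n (code U x) = (\<Sum>i<n. if x \<in> U i then (1/3)^i else 0)"
  shows "(1/3)^n \<le> code U x - greedy n (code U x) \<longleftrightarrow> x \<in> U n"
proof -
  define f :: "nat \<Rightarrow> real" where "f i = (if x \<in> U i then (1/3)^i else 0)" for i
  have sf: "summable f" unfolding f_def by (rule code_summable)
  have split: "code U x - greedy n (code U x) = f n + (\<Sum>i. f (i + Suc n))"
    using suminf_split_initial_segment[OF sf, of "Suc n"] assms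
    unfolding code_def f_def by simp
  have s3: "summable (\<lambda>i. (1/3::real)^(i + Suc n))"
    using summable_ignore_initial_segment[OF summable_geometric[of "1/3::real"], of "Suc n"] by simp
  have nonneg: "0 \<le> (\<Sum>i. f (i + Suc n))"
    by (intro suminf_nonneg summable_ignore_initial_segment sf) (simp add: f_def)
  have "(\<Sum>i. f (i + Suc n)) \<le> (\<Sum>i. (1/3)^(i + Suc n))"
    by (intro suminf_le summable_ignore_initial_segment sf s3) (simp add: f_def)
  also have "(\<Sum>i. (1/3::real)^(i + Suc n)) = (\<Sum>i. (1/3)^i * (1/3)^Suc n)"
    by (simp add: power_add)
  also have "\<dots> = (\<Sum>i. (1/3)^i) * (1/3)^Suc n"
    by (intro suminf_mult2[symmetric] summable_geometric) simp
  also have "\<dots> = (1/3)^n / 2"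
    by (subst suminf_geometric) auto
  also have "\<dots> < (1/3)^n" by simp
  finally have "(\<Sum>i. f (i + Suc n)) < (1/3)^n" .
  with nonneg show ?thesis unfolding split by (auto simp: f_def)
qed

lemma greedy_code: "greedy n (code U x) = (\<Sum>i<n. if x \<in> U i then (1/3)^i else 0)"
proof (induction n)
  case (Suc n)
  have "greedy (Suc n) (code U x) = greedy n (code U x) + (if x \<in> U n then (1/3)^n else 0)"
    by (simp only: greedy.simps(2) code_digit[OF Suc])
  then show ?case by (simp add: Suc)
qed simp

text \<open>The Borel set is the test that reads digit \<open>n\<close> off a real number, so it is
  available for arbitrary sets \<open>U n\<close>. It transfers sets back through the code: for the
  left inverse on a Polish space and for injectivity on the sample space.\<close>

lemma code_separates: "\<exists>B\<in>sets borel. \<forall>x. x \<in> U n \<longleftrightarrow> code U x \<in> B"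
proof (intro bexI allI)
  show "x \<in> U n \<longleftrightarrow> code U x \<in> {r. (1/3)^n \<le> r - greedy n r}" for x
    by (simp only: mem_Collect_eq code_digit[OF greedy_code])
  show "{r. (1/3)^n \<le> r - greedy n r} \<in> sets borel"
    by measurable
qed

section \<open>Polish spaces as measurable retracts of the real line\<close>

lemma ex_countable_basis_sequence:
  "\<exists>U :: nat \<Rightarrow> 'a::second_countable_topology set. (\<forall>n. open (U n)) \<and>
     (\<forall>V x. open V \<longrightarrow> x \<in> V \<longrightarrow> (\<exists>n. x \<in> U n \<and> U n \<subseteq> V))"
proof -
  obtain B :: "'a set set" where B: "countable B" "topological_basis B"
    using ex_countable_basis by blast
  have "B \<noteq> {}"
    using topological_basisE[OF B(2), of UNIV undefined] by (metis UNIV_I empty_iff open_UNIV)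
  then have r: "range (from_nat_into B) = B"
    using B(1) by (simp add: range_from_nat_into)
  show ?thesis
  proof (intro exI[of _ "from_nat_into B"] conjI allI impI)
    show "open (from_nat_into B n)" for n
      using r topological_basis_open[OF B(2)] by auto
    show "\<exists>n. x \<in> from_nat_into B n \<and> from_nat_into B n \<subseteq> V" if "open V" "x \<in> V" for V x
      using topological_basisE[OF B(2) that] r by (metis imageE)
  qed
qed

text \<open>The left inverse is the limit of maps that pick, for a code, the first point of a countable
  dense set whose ball of radius \<open>1/n\<close> contains the coded point. This avoids the Lusin--Souslin
  theorem.\<close>

lemma polish_retract_real:
  "\<exists>(h :: 'a::polish_space \<Rightarrow> real) (g :: real \<Rightarrow> 'a).
     h \<in> borel_measurable borel \<and> g \<in> borel_measurable borel \<and> (\<forall>x. g (h x) = x)"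
proof -
  obtain U :: "nat \<Rightarrow> 'a set" where U: "\<And>n. open (U n)"
    and basis: "\<And>V x. open V \<Longrightarrow> x \<in> V \<Longrightarrow> \<exists>n. x \<in> U n \<and> U n \<subseteq> V"
    using ex_countable_basis_sequence by blast
  define h where "h = code U"
  have h[measurable]: "h \<in> borel_measurable borel"
    unfolding h_def by (rule code_measurable) (use U in auto)
  obtain D where D: "\<And>n. D n \<in> sets borel" "\<And>n x. x \<in> U n \<longleftrightarrow> h x \<in> D n"
    using code_separates[of U] unfolding h_def by metis
  have sep: "\<exists>B\<in>sets borel. \<forall>x. x \<in> V \<longleftrightarrow> h x \<in> B" if "open V" for V
  proof (intro bexI allI)
    show "(\<Union>n\<in>{n. U n \<subseteq> V}. D n) \<in> sets borel"
      using D(1) by auto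
    show "x \<in> V \<longleftrightarrow> h x \<in> (\<Union>n\<in>{n. U n \<subseteq> V}. D n)" for x
      using basis[OF that, of x] D(2) by auto
  qed
  obtain S :: "'a set" where S: "countable S" "\<And>V. open V \<Longrightarrow> V \<noteq> {} \<Longrightarrow> \<exists>s\<in>S. s \<in> V"
    using countable_dense_setE by metis
  define d where "d = from_nat_into S"
  have "S \<noteq> {}" using S(2)[of UNIV] by auto
  then have d: "\<And>V. open V \<Longrightarrow> V \<noteq> {} \<Longrightarrow> \<exists>k. d k \<in> V"
    using S unfolding d_def by (metis from_nat_into_surj)
  have "\<forall>n k. \<exists>B\<in>sets borel. \<forall>x. x \<in> ball (d k) (1 / Suc n) \<longleftrightarrow> h x \<in> B"
    using sep by blast
  then obtain B where B: "\<And>n k. B n k \<in> sets borel"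
    "\<And>n k x. x \<in> ball (d k) (1 / Suc n) \<longleftrightarrow> h x \<in> B n k"
    by metis
  define t where "t n r = d (LEAST k. r \<in> B n k)" for n r
  have tm[measurable]: "t n \<in> borel_measurable borel" for n
  proof -
    have [measurable]: "\<And>k. B n k \<in> sets borel" using B by blast
    have "(\<lambda>r. LEAST k. r \<in> B n k) \<in> borel \<rightarrow>\<^sub>M count_space UNIV" by measurable
    from measurable_compose[OF this, of d] show ?thesis unfolding t_def by simp
  qed
  have th: "dist (t n (h x)) x < 1 / Suc n" for n x
  proof -
    obtain k where "d k \<in> ball x (1 / Suc n)"
      using d[of "ball x (1 / Suc n)"] by auto
    then have "h x \<in> B n k" by (subst B(2)[symmetric]) (simp add: dist_commute)
    then have "h x \<in> B n (LEAST k. h x \<in> B n k)" by (rule LeastI)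
    then show ?thesis by (simp add: B(2)[symmetric] t_def)
  qed
  have lim: "(\<lambda>n. t n (h x)) \<longlonglongrightarrow> x" for x
  proof (rule tendstoI)
    fix e :: real assume "0 < e"
    then obtain N where N: "1 / Suc N < e" using nat_approx_posE by blast
    show "\<forall>\<^sub>F n in sequentially. dist (t n (h x)) x < e"
      using eventually_ge_at_top[of N]
    proof eventually_elim
      case (elim n)
      have "1 / real (Suc n) \<le> 1 / Suc N" using elim by (intro divide_left_mono) auto
      with th[of n x] N show ?case by linarith
    qed
  qed
  \<comment> \<open>Codes outside the range of \<open>h\<close> need not give a convergent sequence.
    By completeness \<open>C\<close> is the set of convergence; off \<open>C\<close> the constant
    \<open>d 0\<close> is substituted, so that the limit exists for every \<open>r\<close> and is
    measurable.\<close>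
  define C where "C = {r. Cauchy (\<lambda>n. t n r)}"
  have C[measurable]: "C \<in> sets borel"
    unfolding C_def using sets_Collect_Cauchy[of t borel] tm by simp
  define u where "u n r = (if r \<in> C then t n r else d 0)" for n r
  define g where "g r = lim (\<lambda>n. u n r)" for r
  have conv: "(\<lambda>n. u n r) \<longlonglongrightarrow> g r" for r
  proof -
    have "convergent (\<lambda>n. u n r)"
      using Cauchy_convergent[of "\<lambda>n. t n r"]
      by (cases "r \<in> C") (auto simp: u_def C_def convergent_const)
    then show ?thesis by (simp add: g_def convergent_LIMSEQ_iff)
  qed
  have "u n \<in> borel_measurable borel" for n
    unfolding u_def by measurable
  then have "g \<in> borel_measurable borel"
    by (rule borel_measurable_LIMSEQ_metric[of u, OF _ conv])
  moreover have "g (h x) = x" for x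
  proof -
    have "h x \<in> C" using LIMSEQ_imp_Cauchy[OF lim[of x]] by (simp add: C_def)
    then have "(\<lambda>n. u n (h x)) \<longlonglongrightarrow> x" using lim[of x] by (simp add: u_def)
    with conv[of "h x"] show ?thesis by (rule LIMSEQ_unique)
  qed
  ultimately show ?thesis using h by blast
qed

section \<open>Realising laws by random variables\<close>

text \<open>Probability integral transform: a diffuse law has a continuous distribution function,
  and this function applied to \<open>h\<close> is uniform on the unit interval.\<close>

lemma (in prob_space) uniform_of_diffuse:
  assumes h[measurable]: "h \<in> borel_measurable M"
    and diffuse: "\<And>r::real. prob {q \<in> space M. h q = r} = 0"
  shows "\<exists>U\<in>borel_measurable M. \<forall>u. 0 < u \<longrightarrow> u < 1 \<longrightarrow> prob {q \<in> space M. U q \<le> u} = u"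
proof -
  interpret N: real_distribution "distr M borel h" by simp
  let ?G = "cdf (distr M borel h)"
  have Gdef: "?G t = prob {q \<in> space M. h q \<le> t}" for t
    by (auto simp: cdf_def measure_distr intro!: arg_cong[where f=prob])
  have "measure (distr M borel h) {r} = 0" for r
    using diffuse[of r] by (subst measure_distr) (auto simp: vimage_def Int_def conj_commute)
  then have cont: "continuous_on UNIV ?G"
    by (auto simp: continuous_at_imp_continuous_on N.isCont_cdf)
  have mono: "mono ?G" by (simp add: monoI N.cdf_nondecreasing)
  have [measurable]: "?G \<in> borel_measurable borel"
    using borel_measurable_continuous_onI[OF cont] .
  have "prob {q \<in> space M. ?G (h q) \<le> u} = u" if u: "0 < u" "u < 1" for u
  proof -
    let ?A = "{t. ?G t \<le> u}"
    have "\<forall>\<^sub>F t in at_top. u < ?G t"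
      using order_tendstoD(1)[OF N.cdf_lim_at_top_prob u(2)] .
    then obtain b where b: "u < ?G b" by (auto simp: eventually_at_top_linorder)
    have "\<forall>\<^sub>F t in at_bot. ?G t < u"
      using order_tendstoD(2)[OF N.cdf_lim_at_bot u(1)] .
    then obtain a where a: "?G a < u" by (auto simp: eventually_at_bot_linorder)
    have bdd: "bdd_above ?A"
    proof (rule bdd_aboveI)
      fix t assume "t \<in> ?A"
      then show "t \<le> b" using monoD[OF mono, of b t] b by fastforce
    qed
    have ne: "?A \<noteq> {}" using a less_imp_le by blast
    have cl: "closed ?A"
      using closed_Collect_le[OF cont continuous_on_const] by simp
    \<comment> \<open>By continuity and monotonicity the sublevel set is a closed half-line with
      right end \<open>s\<close>, and the intermediate value theorem gives \<open>?G s = u\<close>.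
      The event in question is thus \<open>h q \<le> s\<close>, of probability
      \<open>?G s\<close>.\<close>
    define s where "s = Sup ?A"
    have sA: "s \<in> ?A" unfolding s_def by (rule closed_contains_Sup[OF ne bdd cl])
    have iff: "?G t \<le> u \<longleftrightarrow> t \<le> s" for t
      using sA monoD[OF mono, of t s] cSup_upper[OF _ bdd, of t] unfolding s_def by auto
    have "?G s = u"
    proof -
      have "a \<le> b" using monoD[OF mono, of b a] a b by linarith
      then obtain t where t: "?G t = u"
        using IVT'[of ?G a u b] a b cont continuous_on_subset by (metis less_imp_le top_greatest)
      then have "t \<le> s" using iff[of t] by auto
      then show ?thesis using monoD[OF mono, of t s] t sA by auto
    qed
    then show ?thesis by (simp add: iff Gdef[symmetric])
  qed
  then show ?thesis
    by (intro bexI[of _ "\<lambda>q. ?G (h q)"]) auto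
qed

text \<open>The hypothesis speaks of the open interval only; letting \<open>u\<close> tend to 0 and
  to 1 shows by monotonicity that no mass lies outside it, which also settles the two
  endpoints.\<close>

lemma (in prob_space) uniform_cdf:
  assumes U[measurable]: "U \<in> borel_measurable M"
    and unif: "\<forall>u::real. 0 < u \<longrightarrow> u < 1 \<longrightarrow> prob {q \<in> space M. U q \<le> u} = u"
  shows "AE q in M. 0 < U q \<and> U q < 1"
    and "0 \<le> u \<Longrightarrow> u \<le> 1 \<Longrightarrow> prob {q \<in> space M. U q \<le> u} = u"
proof -
  have le0: "prob {q \<in> space M. U q \<le> 0} \<le> 0"
  proof (rule dense_ge)
    fix u :: real assume "0 < u"
    \<comment> \<open>The minimum with \<open>1/2\<close> keeps the argument inside the open unit
      interval, where \<open>unif\<close> applies.\<close>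
    then have "prob {q \<in> space M. U q \<le> 0} \<le> prob {q \<in> space M. U q \<le> min u (1/2)}"
      by (intro finite_measure_mono) auto
    also have "\<dots> \<le> u" using \<open>0 < u\<close> by (subst unif[rule_format]) auto
    finally show "prob {q \<in> space M. U q \<le> 0} \<le> u" .
  qed
  then have p0: "prob {q \<in> space M. U q \<le> 0} = 0" by (simp add: antisym)
  have ge1: "1 \<le> prob {q \<in> space M. U q < 1}"
  proof (rule dense_le)
    fix u :: real assume "u < 1"
    then have "u \<le> prob {q \<in> space M. U q \<le> max u (1/2)}"
      by (subst unif[rule_format]) auto
    also have "\<dots> \<le> prob {q \<in> space M. U q < 1}"
      using \<open>u < 1\<close> by (intro finite_measure_mono) auto
    finally show "u \<le> prob {q \<in> space M. U q < 1}" .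
  qed
  then have p1: "prob {q \<in> space M. U q < 1} = 1" by (simp add: antisym)
  have "AE q in M. U q < 1" using p1 by (subst (asm) prob_Collect_eq_1) auto
  moreover have "AE q in M. \<not> U q \<le> 0" using p0 by (subst (asm) prob_Collect_eq_0) auto
  ultimately show "AE q in M. 0 < U q \<and> U q < 1" by eventually_elim auto
  show "prob {q \<in> space M. U q \<le> u} = u" if "0 \<le> u" "u \<le> 1"
  proof (cases "u = 1")
    case True
    have "AE q in M. U q \<le> 1" using \<open>AE q in M. U q < 1\<close> by eventually_elim auto
    then show ?thesis using True prob_Collect_eq_1[of "\<lambda>q. U q \<le> 1"] by simp
  next
    case False
    then show ?thesis using that p0 spec[OF unif, of u] by (cases "u = 0") auto
  qed
qed

text \<open>Quantile transform: the generalised inverse \<open>N.I\<close> of the distribution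
  function of \<nu>, applied to a uniform variable, has law \<nu>.\<close>

lemma (in prob_space) realise_real:
  assumes h: "h \<in> borel_measurable M" "\<And>r::real. prob {q \<in> space M. h q = r} = 0"
    and \<nu>: "real_distribution \<nu>"
  shows "\<exists>R\<in>borel_measurable M. distr M borel R = \<nu>"
proof -
  interpret N: cdf_distribution \<nu> using \<nu> by (simp add: cdf_distribution_def)
  obtain U where U[measurable]: "U \<in> borel_measurable M"
    and unif: "\<forall>u. 0 < u \<longrightarrow> u < 1 \<longrightarrow> prob {q \<in> space M. U q \<le> u} = u"
    using uniform_of_diffuse[OF h] by blast
  note U01 = uniform_cdf[OF U unif]
  \<comment> \<open>The relation between \<open>N.I\<close> and the distribution function holds on
    the open unit interval, where \<open>U\<close> lies almost surely; the value 0 elsewhere is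
    arbitrary.\<close>
  define k where "k u = (if u \<in> {0<..<1} then N.I u else 0)" for u :: real
  have [measurable]: "k \<in> borel_measurable borel"
    unfolding k_def using N.measurable_CI
    by (subst (asm) measurable_restrict_space_iff[where c=0]) auto
  have "distr M borel (\<lambda>q. k (U q)) = \<nu>"
  proof (rule cdf_unique[OF _ \<nu>], simp, rule ext)
    fix x
    have "cdf (distr M borel (\<lambda>q. k (U q))) x = prob {q \<in> space M. k (U q) \<le> x}"
      by (auto simp: cdf_def measure_distr intro!: arg_cong[where f=prob])
    also have "\<dots> = prob {q \<in> space M. U q \<le> cdf \<nu> x}"
    proof (rule finite_measure_eq_AE)
      show "AE q in M. q \<in> {q \<in> space M. k (U q) \<le> x} \<longleftrightarrow> q \<in> {q \<in> space M. U q \<le> cdf \<nu> x}"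
        using U01(1) by eventually_elim (auto simp: k_def N.pseudoinverse[symmetric])
    qed auto
    also have "\<dots> = cdf \<nu> x"
      by (rule U01(2)) (auto simp: N.cdf_nonneg N.cdf_bounded_prob)
    finally show "cdf (distr M borel (\<lambda>q. k (U q))) x = cdf \<nu> x" .
  qed
  then show ?thesis by (intro bexI[of _ "\<lambda>q. k (U q)"]) auto
qed

text \<open>Atomlessness in a usable form. Unlike a fixed uniform variable, a diffuse one stays
  diffuse after conditioning on an event of positive probability, so every law can again be realised
  on such an event.\<close>

locale diffuse_prob_space = prob_space +
  assumes ex_diffuse: "\<exists>h\<in>borel_measurable M. \<forall>r::real. prob {q \<in> space M. h q = r} = 0"

text \<open>The code of a countable basis separates points, so each of its level sets has at most
  one point. A level set of positive mass would then be an atom, its only subsets being itself and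
  the empty set.\<close>

lemma diffuse_of_standard_borel:
  assumes "prob_space M" "standard_borel M" "atomless M"
  shows "diffuse_prob_space M"
proof -
  interpret prob_space M by fact
  obtain T where T: "topspace T = space M" "completely_metrizable_space T" "second_countable T"
    and sM: "sets M = sigma_sets (space M) {U. openin T U}"
    using assms(2) unfolding standard_borel_def by blast
  obtain B where B: "countable B" "\<forall>V\<in>B. openin T V"
    and basis: "\<forall>U x. openin T U \<and> x \<in> U \<longrightarrow> (\<exists>V\<in>B. x \<in> V \<and> V \<subseteq> U)"
    using T(3) unfolding second_countable_def by blast
  obtain q0 where "q0 \<in> space M" using not_empty by blast
  then have "B \<noteq> {}" using basis openin_topspace[of T] T(1) by blast
  then have rB: "range (from_nat_into B) = B" using B(1) by (simp add: range_from_nat_into)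
  define h where "h = code (from_nat_into B)"
  have h: "h \<in> borel_measurable M" unfolding h_def
    using B(2) rB by (intro code_measurable) (auto simp: sM intro!: sigma_sets.Basic)
  have t1: "t1_space T"
    using T(2) by (simp add: completely_metrizable_imp_metrizable_space metrizable_imp_t1_space)
  have inj: "q = q'" if q: "q \<in> space M" "q' \<in> space M" "h q = h q'" for q q'
  proof (rule ccontr)
    assume "q \<noteq> q'"
    then obtain U where U: "openin T U" "q \<in> U" "q' \<notin> U"
      using t1 q T(1) unfolding t1_space_def by metis
    then obtain V where "V \<in> B" "q \<in> V" "V \<subseteq> U" using basis by blast
    then obtain n where n: "q \<in> from_nat_into B n" "q' \<notin> from_nat_into B n"
      using rB U(3) by (metis imageE subsetD)
    obtain D where "\<forall>x. x \<in> from_nat_into B n \<longleftrightarrow> h x \<in> D"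
      using code_separates[of "from_nat_into B" n] unfolding h_def by blast
    with n q(3) show False by auto
  qed
  have "prob {q \<in> space M. h q = r} = 0" for r
  proof (rule ccontr)
    let ?A = "{q \<in> space M. h q = r}"
    assume "prob ?A \<noteq> 0"
    then have "emeasure M ?A > 0" by (simp add: emeasure_eq_measure zero_less_measure_iff)
    moreover have A: "?A \<in> sets M" using h by measurable
    ultimately obtain C where C: "C \<in> sets M" "C \<subseteq> ?A" "emeasure M C \<noteq> 0" "emeasure M C \<noteq> emeasure M ?A"
      using assms(3) unfolding atomless_def by blast
    then obtain q where "q \<in> C" by (metis all_not_in_conv emeasure_empty)
    then have "C = ?A" using inj C(2) by blast
    with C(4) show False by simp
  qed
  with h show ?thesis by unfold_locales blast
qed

text \<open>The law is pushed to the real line by the encoding, realised there by quantiles, and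
  brought back by the measurable left inverse.\<close>

lemma (in diffuse_prob_space) realise_law:
  fixes \<mu> :: "'b::polish_space measure"
  assumes \<mu>: "prob_space \<mu>" "sets \<mu> = sets borel"
  shows "\<exists>Z\<in>borel_measurable M. distr M borel Z = \<mu>"
proof -
  obtain e :: "'b \<Rightarrow> real" and g where [measurable]: "e \<in> borel_measurable borel" "g \<in> borel_measurable borel"
    and ge: "\<And>x. g (e x) = x"
    using polish_retract_real by blast
  interpret \<mu>: prob_space \<mu> by fact
  have [measurable_cong]: "sets \<mu> = sets borel" by fact
  have "real_distribution (distr \<mu> borel e)" by (rule \<mu>.real_distribution_distr) measurable
  then obtain R where [measurable]: "R \<in> borel_measurable M"
    and R: "distr M borel R = distr \<mu> borel e"
    using realise_real ex_diffuse by metis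
  have "distr M borel (\<lambda>q. g (R q)) = distr (distr M borel R) borel g"
    by (subst distr_distr) (auto simp: comp_def)
  also have "\<dots> = distr \<mu> borel (\<lambda>x. x)"
    unfolding R by (subst distr_distr) (auto simp: comp_def ge)
  also have "\<dots> = \<mu>" by (rule distr_id2) (simp add: \<mu>)
  finally show ?thesis by (intro bexI[of _ "\<lambda>q. g (R q)"]) auto
qed

section \<open>Conditioning and realisation cell by cell\<close>

lemma (in diffuse_prob_space) diffuse_uniform_measure:
  assumes "E \<in> sets M" "emeasure M E \<noteq> 0"
  shows "diffuse_prob_space (uniform_measure M E)"
proof -
  interpret N: prob_space "uniform_measure M E"
    using assms by (intro prob_space_uniform_measure) auto
  obtain h where h[measurable]: "h \<in> borel_measurable M"
    and diffuse: "\<And>r::real. prob {q \<in> space M. h q = r} = 0"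
    using ex_diffuse by blast
  have "measure (uniform_measure M E) {q \<in> space M. h q = r} = 0" for r
  proof -
    have "prob (E \<inter> {q \<in> space M. h q = r}) \<le> prob {q \<in> space M. h q = r}"
      by (intro finite_measure_mono) auto
    then have "emeasure M (E \<inter> {q \<in> space M. h q = r}) = 0"
      using diffuse[of r] by (simp add: emeasure_eq_measure antisym)
    then show ?thesis
      using assms(1) by (simp add: measure_def)
  qed
  then show ?thesis
    by (intro diffuse_prob_space.intro N.prob_space_axioms diffuse_prob_space_axioms.intro
        bexI[of _ h] allI) simp_all
qed

text \<open>The conditional law of \<pi> given \<open>S\<close> is realised on the sample space
  conditioned on \<open>E\<close>. Since \<open>S\<close> and \<open>E\<close> have the same mass,
  the two normalising factors cancel.\<close>

lemma (in diffuse_prob_space) realise_on: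
  fixes \<pi> :: "'b::polish_space measure"
  assumes \<pi>: "prob_space \<pi>" "sets \<pi> = sets borel"
    and E: "E \<in> sets M" and S: "S \<in> sets borel" and eq: "emeasure \<pi> S = emeasure M E"
  shows "\<exists>W\<in>borel_measurable M. \<forall>A\<in>sets borel. emeasure M (E \<inter> W -` A) = emeasure \<pi> (S \<inter> A)"
proof (cases "emeasure M E = 0")
  \<comment> \<open>Conditioning is impossible here, but both sides vanish for any choice of
    \<open>W\<close>.\<close>
  case True
  have "emeasure M (E \<inter> (\<lambda>_. undefined) -` A) = emeasure \<pi> (S \<inter> A)" for A :: "'b set"
  proof -
    have "emeasure M (E \<inter> (\<lambda>_. undefined) -` A) \<le> emeasure M E" by (intro emeasure_mono E) auto
    moreover have "emeasure \<pi> (S \<inter> A) \<le> emeasure \<pi> S"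
      using S \<pi>(2) by (intro emeasure_mono) auto
    ultimately show ?thesis using True eq by simp
  qed
  then show ?thesis by (intro bexI[of _ "\<lambda>_. undefined"]) auto
next
  case False
  interpret \<pi>: prob_space \<pi> by fact
  interpret N: diffuse_prob_space "uniform_measure M E"
    using diffuse_uniform_measure[OF E False] .
  have "emeasure \<pi> S \<noteq> 0" using eq False by simp
  then have "prob_space (uniform_measure \<pi> S)" by (intro prob_space_uniform_measure) auto
  from N.realise_law[OF this] \<pi>(2) obtain W where W: "W \<in> borel_measurable (uniform_measure M E)"
    "distr (uniform_measure M E) borel W = uniform_measure \<pi> S"
    unfolding sets_uniform_measure by blast
  have Wm: "W \<in> borel_measurable M"
    using W(1) unfolding measurable_cong_sets[OF sets_uniform_measure refl] .
  have "emeasure M (E \<inter> W -` A) = emeasure \<pi> (S \<inter> A)" if A: "A \<in> sets borel" for A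
  proof -
    have WA: "W -` A \<inter> space M \<in> sets M" using Wm A by (rule measurable_sets)
    have sp: "E \<inter> (W -` A \<inter> space M) = E \<inter> W -` A" using sets.sets_into_space[OF E] by blast
    have "emeasure M (E \<inter> W -` A) / emeasure M E = emeasure (distr (uniform_measure M E) borel W) A"
      using W(1) A E WA sp by (simp add: emeasure_distr)
    also have "\<dots> = emeasure \<pi> (S \<inter> A) / emeasure M E"
      using A S \<pi>(2) eq by (simp add: W(2))
    finally have "emeasure M (E \<inter> W -` A) * emeasure M E / emeasure M E
        = emeasure \<pi> (S \<inter> A) * emeasure M E / emeasure M E"
      by (metis ennreal_times_divide mult.commute)
    then show ?thesis
      using False by (simp add: ennreal_mult_divide_eq)
  qed
  with Wm show ?thesis by blast
qed

text \<open>Corresponding cells of the target and of the sample space have equal mass, so \<pi>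
  restricted to cell \<open>k\<close> is realised on the sample cell \<open>k\<close>. Gluing the
  countably many pieces gives law \<pi> and keeps every value in its cell.\<close>

lemma (in diffuse_prob_space) realise_cellwise:
  fixes \<pi> :: "'b::polish_space measure" and s :: "'b \<Rightarrow> nat" and t :: "'a \<Rightarrow> nat"
  assumes \<pi>: "prob_space \<pi>" "sets \<pi> = sets borel"
    and s[measurable]: "s \<in> borel \<rightarrow>\<^sub>M count_space UNIV"
    and t[measurable]: "t \<in> M \<rightarrow>\<^sub>M count_space UNIV"
    and eq: "\<And>k. emeasure \<pi> (s -` {k}) = emeasure M (t -` {k} \<inter> space M)"
  shows "\<exists>W\<in>borel_measurable M. distr M borel W = \<pi> \<and> (AE q in M. s (W q) = t q)"
proof -
  have [measurable_cong]: "sets \<pi> = sets borel" by fact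
  have S: "s -` {k} \<in> sets borel" for k
    using measurable_sets[OF s, of "{k}"] by simp
  have E: "t -` {k} \<inter> space M \<in> sets M" for k
    using measurable_sets[OF t, of "{k}"] by simp
  have "\<exists>W\<in>borel_measurable M. \<forall>A\<in>sets borel.
      emeasure M (t -` {k} \<inter> space M \<inter> W -` A) = emeasure \<pi> (s -` {k} \<inter> A)" for k
    by (rule realise_on[OF \<pi> E S eq])
  then obtain V where V[measurable]: "\<And>k. V k \<in> borel_measurable M"
    and em: "\<And>k A. A \<in> sets borel \<Longrightarrow>
      emeasure M (t -` {k} \<inter> space M \<inter> V k -` A) = emeasure \<pi> (s -` {k} \<inter> A)"
    by metis
  define W where "W q = V (t q) q" for q
  have [measurable]: "W \<in> borel_measurable M"
    unfolding W_def by (rule measurable_compose_countable[OF V t])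
  have "distr M borel W = \<pi>"
  proof (rule measure_eqI)
    fix A assume "A \<in> sets (distr M borel W)"
    then have A[measurable]: "A \<in> sets borel" by simp
    have m: "t -` {k} \<inter> space M \<inter> V k -` A \<in> sets M" for k
    proof -
      have "t -` {k} \<inter> space M \<inter> V k -` A = t -` {k} \<inter> space M \<inter> (V k -` A \<inter> space M)" by blast
      then show ?thesis using E[of k] measurable_sets[OF V[of k] A] by simp
    qed
    have "emeasure (distr M borel W) A = emeasure M (W -` A \<inter> space M)"
      by (simp add: emeasure_distr)
    also have "W -` A \<inter> space M = (\<Union>k. t -` {k} \<inter> space M \<inter> V k -` A)"
      by (auto simp: W_def)
    also have "emeasure M \<dots> = (\<Sum>k. emeasure M (t -` {k} \<inter> space M \<inter> V k -` A))"
      using m by (intro suminf_emeasure[symmetric]) (auto simp: disjoint_family_on_def)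
    also have "\<dots> = (\<Sum>k. emeasure \<pi> (s -` {k} \<inter> A))" by (simp add: em)
    also have "\<dots> = emeasure \<pi> (\<Union>k. s -` {k} \<inter> A)"
      using S \<pi>(2) by (intro suminf_emeasure) (auto simp: disjoint_family_on_def)
    also have "(\<Union>k. s -` {k} \<inter> A) = A" by blast
    finally show "emeasure (distr M borel W) A = emeasure \<pi> A" .
  qed (simp add: \<pi>)
  moreover have "AE q in M. s (W q) = t q"
  proof -
    \<comment> \<open>Choosing the complement of cell \<open>k\<close> as the test set in
      \<open>em\<close> shows that \<open>V k\<close> leaves its cell only on a null set.\<close>
    have "AE q in M. \<not> (t q = k \<and> s (V k q) \<noteq> k)" for k
    proof (rule AE_I')
      have "{q \<in> space M. t q = k \<and> s (V k q) \<noteq> k} = t -` {k} \<inter> space M \<inter> V k -` (- s -` {k})"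
        by auto
      moreover have "emeasure M (t -` {k} \<inter> space M \<inter> V k -` (- s -` {k})) = 0"
        using em[of "- s -` {k}" k] S[of k] by auto
      moreover have "{q \<in> space M. t q = k \<and> s (V k q) \<noteq> k} \<in> sets M" by measurable
      ultimately show "{q \<in> space M. t q = k \<and> s (V k q) \<noteq> k} \<in> null_sets M" by auto
    qed auto
    then have "AE q in M. \<forall>k. \<not> (t q = k \<and> s (V k q) \<noteq> k)" unfolding AE_all_countable by blast
    then show ?thesis by eventually_elim (auto simp: W_def)
  qed
  ultimately show ?thesis by (intro bexI[of _ W]) auto
qed

instance prod :: (polish_space, polish_space) polish_space ..

lemma borel_measurable_fst [measurable]:
  "fst \<in> (borel :: ('b::topological_space \<times> 'c::topological_space) measure) \<rightarrow>\<^sub>M borel"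
  by (intro borel_measurable_continuous_onI continuous_intros)

lemma borel_measurable_snd [measurable]:
  "snd \<in> (borel :: ('b::topological_space \<times> 'c::topological_space) measure) \<rightarrow>\<^sub>M borel"
  by (intro borel_measurable_continuous_onI continuous_intros)

section \<open>Optimal costs with one prescribed random variable\<close>

text \<open>The cells of level \<open>n\<close> are cut out by the level sets of \<open>\<lfloor>b\<rfloor>\<close> and the first \<open>n\<close> sets
  of \<open>U\<close>.\<close>

primrec cell :: "('c \<Rightarrow> ennreal) \<Rightarrow> (nat \<Rightarrow> 'c set) \<Rightarrow> nat \<Rightarrow> 'c \<Rightarrow> nat" where
  "cell b U 0 y = (if b y = \<infinity> then 0 else Suc (nat \<lfloor>enn2real (b y)\<rfloor>))"
| "cell b U (Suc n) y = 2 * cell b U n y + (if y \<in> U n then 1 else 0)"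

lemma cell_measurable:
  assumes [measurable]: "b \<in> borel_measurable M" "\<And>n. U n \<in> sets M"
  shows "cell b U n \<in> M \<rightarrow>\<^sub>M count_space UNIV"
proof (induction n)
  case (Suc n)
  note [measurable] = Suc
  show ?case unfolding cell.simps by measurable
qed (unfold cell.simps, measurable)

text \<open>The index is built from binary digits: its parity is the newest membership, its half the
  index of the coarser cell.\<close>

lemma cell_Suc_eqD:
  assumes "cell b U (Suc n) y = cell b U (Suc n) z"
  shows "cell b U n y = cell b U n z" "y \<in> U n \<longleftrightarrow> z \<in> U n"
  using assms by (auto split: if_splits) presburger+

text \<open>Index 0 at level 0 is reserved for \<open>b y = \<infinity>\<close>, so cellmates agree
  on finiteness of \<open>b\<close> and, if finite, on its integer part. This survives refinement
  and bounds the oscillation of \<open>b\<close> by 1 at every level.\<close>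

lemma cell_eqD:
  assumes "cell b U n y = cell b U n z"
  shows "i < n \<Longrightarrow> y \<in> U i \<longleftrightarrow> z \<in> U i" and "b z \<le> b y + 1"
proof -
  show "y \<in> U i \<longleftrightarrow> z \<in> U i" if "i < n"
    using assms that
  proof (induction n)
    case (Suc n)
    then show ?case using cell_Suc_eqD[OF Suc.prems(1)] by (cases "i = n") auto
  qed simp
  have "cell b U 0 y = cell b U 0 z"
    using assms by (induction n) (blast dest: cell_Suc_eqD(1))+
  then consider "b y = \<infinity>" | "b y \<noteq> \<infinity>" "b z \<noteq> \<infinity>" "nat \<lfloor>enn2real (b y)\<rfloor> = nat \<lfloor>enn2real (b z)\<rfloor>"
    by (auto split: if_splits)
  then show "b z \<le> b y + 1"
  proof cases
    case 2
    obtain r s where rs: "b y = ennreal r" "b z = ennreal s" "0 \<le> r" "0 \<le> s"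
      using 2 by (cases "b y"; cases "b z") auto
    with 2 have "\<lfloor>r\<rfloor> = \<lfloor>s\<rfloor>" by (simp add: eq_nat_nat_iff)
    then have "s \<le> r + 1" by linarith
    then have "ennreal s \<le> ennreal (r + 1)" by (rule ennreal_leI)
    then show ?thesis using rs by (simp add: ennreal_plus)
  qed simp
qed

text \<open>The worst-case cost when the second component is known only up to its cell under
  \<open>k\<close>.\<close>

definition cell_sup :: "('b \<times> 'c \<Rightarrow> ennreal) \<Rightarrow> ('c \<Rightarrow> nat) \<Rightarrow> 'b \<times> 'c \<Rightarrow> ennreal" where
  "cell_sup c k p = (SUP z\<in>{z. k z = k (snd p)}. c (fst p, z))"

lemma cell_sup_upper: "k z = k (snd p) \<Longrightarrow> c (fst p, z) \<le> cell_sup c k p"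
  unfolding cell_sup_def by (intro SUP_upper) simp

text \<open>With the cell fixed, a supremum of continuous functions of the first variable is lower
  semicontinuous, even over uncountably many \<open>z\<close>. Countably many cells are then
  glued.\<close>

lemma cell_sup_measurable:
  fixes c :: "'b::second_countable_topology \<times> 'c::second_countable_topology \<Rightarrow> ennreal"
  assumes c: "continuous_on UNIV c" and k[measurable]: "k \<in> borel \<rightarrow>\<^sub>M count_space UNIV"
  shows "cell_sup c k \<in> borel_measurable borel"
proof -
  define s where "s j x = (SUP z\<in>{z. k z = j}. c (x, z))" for j x
  have [measurable]: "s j \<in> borel_measurable borel" for j
  proof (rule borel_measurableI_greater)
    fix r
    have "open {x. r < c (x, z)}" for z
      by (intro open_Collect_less continuous_on_const continuous_on_compose2[OF c]
          continuous_intros) auto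
    then have "open (\<Union>z\<in>{z. k z = j}. {x. r < c (x, z)})" by blast
    moreover have "{x \<in> space borel. r < s j x} = (\<Union>z\<in>{z. k z = j}. {x. r < c (x, z)})"
      by (auto simp: s_def less_SUP_iff)
    ultimately show "{x \<in> space borel. r < s j x} \<in> sets borel" by simp
  qed
  have "(\<lambda>p. s (k (snd p)) (fst p)) \<in> borel_measurable (borel \<Otimes>\<^sub>M borel)"
  proof (rule measurable_compose_countable)
    show "(\<lambda>p. s j (fst p)) \<in> borel_measurable (borel \<Otimes>\<^sub>M borel)" for j by measurable
    show "(\<lambda>p. k (snd p)) \<in> borel \<Otimes>\<^sub>M borel \<rightarrow>\<^sub>M count_space UNIV" by measurable
  qed
  then show ?thesis unfolding borel_prod cell_sup_def[abs_def] s_def .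
qed

text \<open>Continuity in the second variable gives a basis set \<open>U i\<close> around
  \<open>snd p\<close> on which the cost is close to \<open>c p\<close>; cells fine enough to decide
  membership in \<open>U i\<close> stay inside it.\<close>

lemma cell_sup_tendsto:
  fixes c :: "'b::topological_space \<times> 'c::topological_space \<Rightarrow> ennreal"
  assumes c: "continuous_on UNIV c"
    and basis: "\<And>V x. open V \<Longrightarrow> x \<in> V \<Longrightarrow> \<exists>n. x \<in> U n \<and> U n \<subseteq> V"
  shows "(\<lambda>n. cell_sup c (cell b U n) p) \<longlonglongrightarrow> c p"
proof (rule order_tendstoI)
  have ge: "c p \<le> cell_sup c (cell b U n) p" for n
    using cell_sup_upper[of "cell b U n" "snd p" p c] by simp
  then show "\<forall>\<^sub>F n in sequentially. r < cell_sup c (cell b U n) p" if "r < c p" for r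
    using that by (auto intro: less_le_trans always_eventually)
  show "\<forall>\<^sub>F n in sequentially. cell_sup c (cell b U n) p < r" if r: "c p < r" for r
  proof -
    \<comment> \<open>A supremum inherits only a weak inequality, so a bound strictly below
      \<open>r\<close> is used.\<close>
    obtain r' where r': "c p < r'" "r' < r" using dense[OF r] by blast
    have "open {z. c (fst p, z) < r'}"
      by (intro open_Collect_less continuous_on_const continuous_on_compose2[OF c]
          continuous_intros) auto
    from basis[OF this, of "snd p"] r' obtain i where
      i: "snd p \<in> U i" "U i \<subseteq> {z. c (fst p, z) < r'}" by auto
    show ?thesis
      \<comment> \<open>Membership in \<open>U i\<close> enters the index at level
        \<open>Suc i\<close>, hence the strict bound.\<close>
      using eventually_gt_at_top[of i]
    proof eventually_elim
      case (elim n)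
      have "cell_sup c (cell b U n) p \<le> r'"
        unfolding cell_sup_def
      proof (rule SUP_least)
        fix z assume "z \<in> {z. cell b U n z = cell b U n (snd p)}"
        then have "z \<in> U i" using cell_eqD(1)[of b U n z "snd p" i] elim i(1) by simp
        then show "c (fst p, z) \<le> r'" using i(2) less_imp_le by blast
      qed
      then show ?case using r'(2) by simp
    qed
  qed
qed

text \<open>\<open>f\<close> may generate the whole \<open>\<sigma>\<close>-algebra, so \<open>\<pi>\<close> itself need not be the law of a pair
  \<open>(Z, f)\<close>. Realise it by pairs whose second component stays in the cell of \<open>f\<close> instead.\<close>

lemma (in diffuse_prob_space) ex_near_optimal:
  fixes \<pi> :: "('b::polish_space \<times> 'c::polish_space) measure"
  assumes \<pi>: "prob_space \<pi>" "sets \<pi> = sets borel"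
    and f[measurable]: "f \<in> borel_measurable M"
    and snd: "distr \<pi> borel snd = distr M borel f"
    and c: "continuous_on UNIV c" and cab: "\<And>x y. c (x, y) \<le> a x + b y"
    and [measurable]: "a \<in> borel_measurable borel" "b \<in> borel_measurable borel"
    and a: "(\<integral>\<^sup>+p. a (fst p) \<partial>\<pi>) < \<infinity>" and b: "(\<integral>\<^sup>+p. b (snd p) \<partial>\<pi>) < \<infinity>"
    and e: "(\<integral>\<^sup>+p. c p \<partial>\<pi>) < e"
  shows "\<exists>Z\<in>borel_measurable M. distr M borel Z = distr \<pi> borel fst \<and> (\<integral>\<^sup>+q. c (Z q, f q) \<partial>M) < e"
proof -
  interpret \<pi>: prob_space \<pi> by fact
  have sets\<pi>[measurable_cong]: "sets \<pi> = sets (borel \<Otimes>\<^sub>M borel)" using \<pi>(2) by (simp only: borel_prod)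
  have sp: "space \<pi> = UNIV" using sets_eq_imp_space_eq[OF \<pi>(2)] by simp
  obtain U :: "nat \<Rightarrow> 'c set" where U: "\<And>n. open (U n)"
    and basis: "\<And>V x. open V \<Longrightarrow> x \<in> V \<Longrightarrow> \<exists>n. x \<in> U n \<and> U n \<subseteq> V"
    using ex_countable_basis_sequence by blast
  define k where "k = cell b U"
  define B where "B n = cell_sup c (k n)" for n
  have k[measurable]: "k n \<in> borel \<rightarrow>\<^sub>M count_space UNIV" for n
    unfolding k_def using U by (intro cell_measurable) auto
  have B_borel[measurable]: "B n \<in> borel_measurable borel" for n
    unfolding B_def by (rule cell_sup_measurable[OF c k])
  have B[measurable]: "B n \<in> borel_measurable \<pi>" for n
    using B_borel[of n] by (simp add: measurable_cong_sets[OF \<pi>(2) refl])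
  have cm[measurable]: "c \<in> borel_measurable \<pi>"
    using borel_measurable_continuous_onI[OF c] by (simp add: measurable_cong_sets[OF \<pi>(2) refl])
  have lim: "(\<lambda>n. B n p) \<longlonglongrightarrow> c p" for p
    unfolding B_def k_def by (rule cell_sup_tendsto[OF c basis])
  have bound: "B n p \<le> a (fst p) + b (snd p) + 1" for n p
    unfolding B_def cell_sup_def
  proof (rule SUP_least)
    fix z assume z: "z \<in> {z. k n z = k n (snd p)}"
    have "c (fst p, z) \<le> a (fst p) + b z" by (rule cab)
    also have "b z \<le> b (snd p) + 1"
      using z unfolding k_def by (intro cell_eqD(2)[of _ U n]) simp
    finally show "c (fst p, z) \<le> a (fst p) + b (snd p) + 1" by (simp add: add.assoc add_left_mono)
  qed
  have "(\<integral>\<^sup>+p. a (fst p) + b (snd p) + 1 \<partial>\<pi>) = (\<integral>\<^sup>+p. a (fst p) \<partial>\<pi>) + (\<integral>\<^sup>+p. b (snd p) \<partial>\<pi>) + 1"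
    by (simp add: nn_integral_add \<pi>.emeasure_space_1)
  with a b have fin: "(\<integral>\<^sup>+p. a (fst p) + b (snd p) + 1 \<partial>\<pi>) < \<infinity>"
    by (simp add: ennreal_add_less_top)
  have "(\<lambda>n. \<integral>\<^sup>+p. B n p \<partial>\<pi>) \<longlonglongrightarrow> (\<integral>\<^sup>+p. c p \<partial>\<pi>)"
    by (rule nn_integral_dominated_convergence[OF _ _ _ _ fin]) (auto intro!: bound lim)
  then have "\<forall>\<^sub>F n in sequentially. (\<integral>\<^sup>+p. B n p \<partial>\<pi>) < e"
    using e by (rule order_tendstoD)
  then obtain n where n: "(\<integral>\<^sup>+p. B n p \<partial>\<pi>) < e"
    by (auto simp: eventually_sequentially)
  \<comment> \<open>The components \<open>snd\<close> and \<open>f\<close> have the same law, so the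
    partitions they induce have equal masses cell by cell.\<close>
  have "\<exists>W\<in>borel_measurable M. distr M borel W = \<pi> \<and> (AE q in M. k n (snd (W q)) = k n (f q))"
  proof (rule realise_cellwise[OF \<pi>])
    show "(\<lambda>p. k n (snd p)) \<in> borel \<rightarrow>\<^sub>M count_space UNIV"
      by measurable
    show "(\<lambda>q. k n (f q)) \<in> M \<rightarrow>\<^sub>M count_space UNIV" by measurable
    fix j
    have S: "k n -` {j} \<in> sets borel" using measurable_sets[OF k[of n], of "{j}"] by simp
    have "emeasure \<pi> ((\<lambda>p. k n (snd p)) -` {j}) = emeasure (distr \<pi> borel snd) (k n -` {j})"
      using S by (subst emeasure_distr) (auto simp: sp vimage_def)
    also have "\<dots> = emeasure M ((\<lambda>q. k n (f q)) -` {j} \<inter> space M)"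
      unfolding snd using S by (subst emeasure_distr) (auto simp: vimage_def)
    finally show "emeasure \<pi> ((\<lambda>p. k n (snd p)) -` {j}) = emeasure M ((\<lambda>q. k n (f q)) -` {j} \<inter> space M)" .
  qed
  then obtain W where Wm: "W \<in> borel_measurable M" and W: "distr M borel W = \<pi>"
    "AE q in M. k n (snd (W q)) = k n (f q)" by blast
  have [measurable]: "W \<in> M \<rightarrow>\<^sub>M borel \<Otimes>\<^sub>M borel" using Wm by (simp add: borel_prod)
  have "(\<integral>\<^sup>+q. c (fst (W q), f q) \<partial>M) \<le> (\<integral>\<^sup>+q. B n (W q) \<partial>M)"
  proof (rule nn_integral_mono_AE)
    \<comment> \<open>The point \<open>f q\<close> shares its cell with \<open>snd (W q)\<close> and
      hence competes in the supremum at \<open>W q\<close>.\<close>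
    show "AE q in M. c (fst (W q), f q) \<le> B n (W q)"
      using W(2) by eventually_elim (auto simp: B_def intro: cell_sup_upper)
  qed
  also have "\<dots> = (\<integral>\<^sup>+p. B n p \<partial>distr M borel W)"
    by (subst nn_integral_distr) (simp_all add: Wm)
  also have "\<dots> < e" unfolding W(1) by (rule n)
  finally have "(\<integral>\<^sup>+q. c (fst (W q), f q) \<partial>M) < e" .
  moreover have "distr M borel (\<lambda>q. fst (W q)) = distr (distr M borel W) borel fst"
    by (subst distr_distr) (auto simp: comp_def Wm simp flip: borel_prod)
  then have "distr M borel (\<lambda>q. fst (W q)) = distr \<pi> borel fst" unfolding W(1) .
  moreover have "(\<lambda>q. fst (W q)) \<in> borel_measurable M" by measurable
  ultimately show ?thesis by (intro bexI[of _ "\<lambda>q. fst (W q)"] conjI)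
qed

section \<open>Laws of elements of \<open>L\<^sup>0\<close>\<close>

lemma Prob_iff: "\<mu> \<in> Prob \<longleftrightarrow> prob_space \<mu> \<and> sets \<mu> = sets borel"
  by (auto simp: Prob_def space_prob_algebra)

lemma distr_in_Prob: "prob_space M \<Longrightarrow> f \<in> borel_measurable M \<Longrightarrow> distr M borel f \<in> Prob"
  by (simp add: Prob_iff prob_space.prob_space_distr)

lemma rep_measurable [measurable]: "Z \<in> L0 M \<Longrightarrow> rep Z \<in> borel_measurable M"
  using L0_measurable rep_in by blast

lemma L0_fin_subset: "Z \<in> L0_fin M a \<Longrightarrow> Z \<in> L0 M"
  by (simp add: L0_fin_def)

lemma Prob_fin_subset: "\<mu> \<in> Prob_fin a \<Longrightarrow> \<mu> \<in> Prob"
  by (simp add: Prob_fin_def)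

lemma joint_law_marginals:
  fixes Z1 :: "('q \<Rightarrow> 'a::second_countable_topology) set" and Z2 :: "('q \<Rightarrow> 'b::second_countable_topology) set"
  assumes [measurable]: "Z1 \<in> L0 M" "Z2 \<in> L0 M"
  shows "distr (joint_law M Z1 Z2) borel fst = law M Z1"
    and "distr (joint_law M Z1 Z2) borel snd = law M Z2"
  unfolding joint_law_def law_def by (subst distr_distr; simp add: comp_def)+

lemma lifted_cost_joint_law:
  fixes Z1 :: "('q \<Rightarrow> 'a::second_countable_topology) set" and Z2 :: "('q \<Rightarrow> 'b::second_countable_topology) set"
  assumes [measurable]: "Z1 \<in> L0 M" "Z2 \<in> L0 M" "c \<in> borel_measurable borel"
  shows "lifted_cost M c Z1 Z2 = (\<integral>\<^sup>+p. c p \<partial>joint_law M Z1 Z2)"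
  unfolding joint_law_def lifted_cost_def by (subst nn_integral_distr) auto

context prob_space
begin

lemma law_in_Prob: "Z \<in> L0 M \<Longrightarrow> law M Z \<in> Prob"
  unfolding law_def by (intro distr_in_Prob prob_space_axioms) measurable

lemma law_class: "f \<in> borel_measurable M \<Longrightarrow> law M (ae_eq M `` {f}) = distr M borel f"
  using class_in_L0 law_eq by blast

lemma joint_law_in_couplings:
  fixes Z1 :: "('a \<Rightarrow> 'b::second_countable_topology) set" and Z2 :: "('a \<Rightarrow> 'c::second_countable_topology) set"
  assumes [measurable]: "Z1 \<in> L0 M" "Z2 \<in> L0 M"
  shows "joint_law M Z1 Z2 \<in> couplings (law M Z1) (law M Z2)"
proof -
  have "joint_law M Z1 Z2 \<in> Prob"
    unfolding joint_law_def by (intro distr_in_Prob prob_space_axioms) measurable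
  then show ?thesis using joint_law_marginals[OF assms] by (simp add: couplings_def)
qed

lemma law_in_Prob_fin_iff:
  assumes [measurable]: "Z \<in> L0 M" "a \<in> borel_measurable borel"
  shows "law M Z \<in> Prob_fin a \<longleftrightarrow> Z \<in> L0_fin M a"
  using law_in_Prob[OF assms(1)] assms(1)
  by (simp add: Prob_fin_def L0_fin_def law_def nn_integral_distr)

lemma law_in_Prob_fin:
  "a \<in> borel_measurable borel \<Longrightarrow> Z \<in> L0_fin M a \<Longrightarrow> law M Z \<in> Prob_fin a"
  using law_in_Prob_fin_iff L0_fin_subset by blast

lemma joint_law_in_Prob_fin2_iff:
  fixes Z1 :: "('a \<Rightarrow> 'b::second_countable_topology) set" and Z2 :: "('a \<Rightarrow> 'c::second_countable_topology) set"
  assumes "Z1 \<in> L0 M" "Z2 \<in> L0 M" "a1 \<in> borel_measurable borel" "a2 \<in> borel_measurable borel"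
  shows "joint_law M Z1 Z2 \<in> Prob_fin2 a1 a2 \<longleftrightarrow> Z1 \<in> L0_fin M a1 \<and> Z2 \<in> L0_fin M a2"
  using joint_law_in_couplings[OF assms(1,2)] assms
  by (simp add: Prob_fin2_def couplings_def law_in_Prob_fin_iff)

end

lemma (in diffuse_prob_space) ex_L0_law:
  fixes \<mu> :: "'b::polish_space measure"
  assumes "\<mu> \<in> Prob"
  shows "\<exists>Z\<in>L0 M. law M Z = \<mu>"
  using realise_law[of \<mu>] assms class_in_L0 law_class unfolding Prob_iff by metis

lemma (in diffuse_prob_space) ex_L0_fin_law:
  fixes \<mu> :: "'b::polish_space measure"
  assumes "a \<in> borel_measurable borel" "\<mu> \<in> Prob_fin a"
  shows "\<exists>Z\<in>L0_fin M a. law M Z = \<mu>"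
  using ex_L0_law[of \<mu>] assms law_in_Prob_fin_iff Prob_fin_subset by metis

text \<open>Adding \<open>- r\<close>, which is never -\<infinity>, commutes with the infimum. The
  value \<open>r = -\<infinity>\<close> is included because \<phi> may take it.\<close>

lemma INF_enn2ereal_minus:
  assumes "I \<noteq> {}" "r \<noteq> \<infinity>"
  shows "(INF i\<in>I. enn2ereal (f i) - r) = enn2ereal (INF i\<in>I. f i) - r"
proof -
  have "enn2ereal (INF i\<in>I. f i) = (INF i\<in>I. enn2ereal (f i))"
    by (simp add: Inf_ennreal.rep_eq image_comp comp_def)
  moreover have "(INF i\<in>I. enn2ereal (f i) + - r) = (INF i\<in>I. enn2ereal (f i)) + - r"
    using assms by (intro INF_ereal_add_left) auto
  ultimately show ?thesis by (simp add: minus_ereal_def)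
qed

text \<open>Finite integrals make \<open>f\<close> and \<open>g\<close> finite almost everywhere, so
  the truncation is harmless. This turns the integral in the total superdifferential into a
  difference of two costs.\<close>

lemma integral_enn2real_diff:
  assumes [measurable]: "f \<in> borel_measurable M" "g \<in> borel_measurable M"
    and fin: "(\<integral>\<^sup>+x. f x \<partial>M) < \<infinity>" "(\<integral>\<^sup>+x. g x \<partial>M) < \<infinity>"
  shows "(\<integral>x. enn2real (f x) - enn2real (g x) \<partial>M)
    = enn2real (\<integral>\<^sup>+x. f x \<partial>M) - enn2real (\<integral>\<^sup>+x. g x \<partial>M)"
proof -
  have *: "integrable M (\<lambda>x. enn2real (u x)) \<and>
      (\<integral>x. enn2real (u x) \<partial>M) = enn2real (\<integral>\<^sup>+x. u x \<partial>M)"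
    if [measurable]: "u \<in> borel_measurable M" and u: "(\<integral>\<^sup>+x. u x \<partial>M) < \<infinity>" for u
  proof -
    have "AE x in M. u x \<noteq> \<infinity>" using u by (intro nn_integral_PInf_AE) auto
    then have eq: "(\<integral>\<^sup>+x. ennreal (enn2real (u x)) \<partial>M) = (\<integral>\<^sup>+x. u x \<partial>M)"
      by (intro nn_integral_cong_AE) (auto elim!: eventually_mono simp: less_top)
    then show ?thesis
      using u by (auto intro!: integrableI_nonneg simp: integral_eq_nn_integral)
  qed
  show ?thesis using *[of f] *[of g] fin by simp
qed

section \<open>Lifting\<close>

locale lifted_transport = diffuse_prob_space M for M :: "'q measure" +
  fixes a1 :: "'a::polish_space \<Rightarrow> ennreal" and a2 :: "'b::polish_space \<Rightarrow> ennreal"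
    and c :: "'a \<times> 'b \<Rightarrow> ennreal"
  assumes a1 [measurable]: "a1 \<in> borel_measurable borel"
    and a2 [measurable]: "a2 \<in> borel_measurable borel"
    and cont: "continuous_on UNIV c"
    and c_le: "\<And>x1 x2. c (x1, x2) \<le> a1 x1 + a2 x2"
begin

abbreviation "P1 \<equiv> Prob_fin a1"
abbreviation "P2 \<equiv> Prob_fin a2"
abbreviation "X1 \<equiv> L0_fin M a1"
abbreviation "X2 \<equiv> L0_fin M a2"
abbreviation "C \<equiv> transport_cost c"
abbreviation "Ch \<equiv> lifted_cost M c"

section \<open>Costs of couplings and of pairs of random variables\<close>

lemma c_measurable [measurable]: "c \<in> borel_measurable borel"
  by (rule borel_measurable_continuous_onI[OF cont])

lemma transport_cost_le_lifted: "Z1 \<in> L0 M \<Longrightarrow> Z2 \<in> L0 M \<Longrightarrow> C (law M Z1) (law M Z2) \<le> Ch Z1 Z2"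
  unfolding transport_cost_def lifted_cost_joint_law[OF _ _ c_measurable]
  by (intro INF_lower joint_law_in_couplings)

lemma coupling_cost_finite:
  assumes "\<pi> \<in> couplings \<mu>1 \<mu>2" "\<mu>1 \<in> P1" "\<mu>2 \<in> P2"
  shows "(\<integral>\<^sup>+p. a1 (fst p) \<partial>\<pi>) < \<infinity>" "(\<integral>\<^sup>+p. a2 (snd p) \<partial>\<pi>) < \<infinity>" "(\<integral>\<^sup>+p. c p \<partial>\<pi>) < \<infinity>"
proof -
  have [measurable_cong]: "sets \<pi> = sets borel"
    and m: "distr \<pi> borel fst = \<mu>1" "distr \<pi> borel snd = \<mu>2"
    using assms(1) by (auto simp: couplings_def Prob_iff)
  show f1: "(\<integral>\<^sup>+p. a1 (fst p) \<partial>\<pi>) < \<infinity>"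
    using assms(2) unfolding m[symmetric] Prob_fin_def by (simp add: nn_integral_distr)
  show f2: "(\<integral>\<^sup>+p. a2 (snd p) \<partial>\<pi>) < \<infinity>"
    using assms(3) unfolding m[symmetric] Prob_fin_def by (simp add: nn_integral_distr)
  have "(\<integral>\<^sup>+p. c p \<partial>\<pi>) \<le> (\<integral>\<^sup>+p. a1 (fst p) + a2 (snd p) \<partial>\<pi>)"
    using c_le by (intro nn_integral_mono) (metis prod.collapse)
  also have "\<dots> = (\<integral>\<^sup>+p. a1 (fst p) \<partial>\<pi>) + (\<integral>\<^sup>+p. a2 (snd p) \<partial>\<pi>)"
    by (intro nn_integral_add) measurable
  also have "\<dots> < \<infinity>" using f1 f2 by simp
  finally show "(\<integral>\<^sup>+p. c p \<partial>\<pi>) < \<infinity>" .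
qed

lemma lifted_cost_finite:
  assumes "Z1 \<in> X1" "Z2 \<in> X2"
  shows "Ch Z1 Z2 < \<infinity>"
proof -
  have L: "Z1 \<in> L0 M" "Z2 \<in> L0 M" using assms L0_fin_subset by blast+
  show ?thesis
    unfolding lifted_cost_joint_law[OF L c_measurable]
    by (rule coupling_cost_finite(3)[OF joint_law_in_couplings[OF L]])
      (use assms law_in_Prob_fin a1 a2 in blast)+
qed

text \<open>Only the right-hand argument is prescribed in \<open>ex_near_optimal\<close>; the other case is obtained
  by exchanging the two factors.\<close>

lemma INF_lifted_left:
  assumes Z2: "Z2 \<in> X2" and \<mu>: "\<mu> \<in> P1"
  shows "(INF Z1\<in>{Z1\<in>X1. law M Z1 = \<mu>}. Ch Z1 Z2) = C \<mu> (law M Z2)" (is "?I = _")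
proof (rule antisym)
  have [measurable]: "Z2 \<in> L0 M" using Z2 by (rule L0_fin_subset)
  show "C \<mu> (law M Z2) \<le> ?I"
    by (rule INF_greatest) (auto intro!: transport_cost_le_lifted L0_fin_subset Z2)
  show "?I \<le> C \<mu> (law M Z2)" unfolding transport_cost_def
  proof (rule INF_greatest)
    fix \<pi> assume \<pi>: "\<pi> \<in> couplings \<mu> (law M Z2)"
    then have m: "distr \<pi> borel fst = \<mu>" "distr \<pi> borel snd = law M Z2"
      and ps: "prob_space \<pi>" "sets \<pi> = sets borel"
      by (auto simp: couplings_def Prob_iff)
    note fin = coupling_cost_finite[OF \<pi> \<mu> law_in_Prob_fin[OF a2 Z2]]
    show "?I \<le> (\<integral>\<^sup>+p. c p \<partial>\<pi>)"
    \<comment> \<open>With \<open>Z2\<close> fixed the infimum may fail to be attained, so the cost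
      of \<pi> is approached through every larger \<open>e\<close>.\<close>
    proof (rule dense_ge)
      fix e assume e: "(\<integral>\<^sup>+p. c p \<partial>\<pi>) < e"
      have "\<exists>Z\<in>borel_measurable M. distr M borel Z = distr \<pi> borel fst \<and>
          (\<integral>\<^sup>+q. c (Z q, rep Z2 q) \<partial>M) < e"
        by (rule ex_near_optimal[OF ps _ _ cont c_le a1 a2 fin(1,2) e])
          (simp_all add: m law_def)
      then obtain Z where Z: "Z \<in> borel_measurable M" "distr M borel Z = \<mu>"
        "(\<integral>\<^sup>+q. c (Z q, rep Z2 q) \<partial>M) < e" unfolding m by blast
      let ?Z = "ae_eq M `` {Z}"
      have L: "?Z \<in> L0 M" "Z \<in> ?Z" using class_in_L0[OF Z(1)] by auto
      have law: "law M ?Z = \<mu>" using law_class[OF Z(1)] Z(2) by simp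
      have X: "?Z \<in> X1" using law_in_Prob_fin_iff[OF L(1) a1] law \<mu> by simp
      have "?I \<le> Ch ?Z Z2" using X law by (intro INF_lower) simp
      also have "\<dots> = (\<integral>\<^sup>+q. c (Z q, rep Z2 q) \<partial>M)"
        by (intro lifted_cost_eq L rep_in) fact+
      finally show "?I \<le> e" using Z(3) by simp
    qed
  qed
qed

lemma INF_lifted_right:
  assumes Z1: "Z1 \<in> X1" and \<mu>: "\<mu> \<in> P2"
  shows "(INF Z2\<in>{Z2\<in>X2. law M Z2 = \<mu>}. Ch Z1 Z2) = C (law M Z1) \<mu>" (is "?I = _")
proof (rule antisym)
  have [measurable]: "Z1 \<in> L0 M" using Z1 by (rule L0_fin_subset)
  show "C (law M Z1) \<mu> \<le> ?I"
    by (rule INF_greatest) (auto intro!: transport_cost_le_lifted L0_fin_subset Z1)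
  show "?I \<le> C (law M Z1) \<mu>" unfolding transport_cost_def
  proof (rule INF_greatest)
    fix \<pi> assume \<pi>: "\<pi> \<in> couplings (law M Z1) \<mu>"
    then have m: "distr \<pi> borel fst = law M Z1" "distr \<pi> borel snd = \<mu>"
      and ps: "prob_space \<pi>" and s[measurable_cong]: "sets \<pi> = sets borel"
      by (auto simp: couplings_def Prob_iff)
    interpret \<pi>: prob_space \<pi> by fact
    note fin = coupling_cost_finite[OF \<pi> law_in_Prob_fin[OF a1 Z1] \<mu>]
    let ?c = "\<lambda>p. c (snd p, fst p)" and ?\<pi> = "distr \<pi> borel (\<lambda>p. (snd p, fst p))"
    have [measurable]: "?c \<in> borel_measurable borel" by measurable
    have cont': "continuous_on UNIV ?c"
      by (rule continuous_on_compose2[OF cont]) (auto intro!: continuous_intros)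
    have m': "distr ?\<pi> borel fst = \<mu>" "distr ?\<pi> borel snd = law M Z1"
      unfolding m[symmetric] by (subst distr_distr; simp add: comp_def)+
    show "?I \<le> (\<integral>\<^sup>+p. c p \<partial>\<pi>)"
    proof (rule dense_ge)
      fix e assume e: "(\<integral>\<^sup>+p. c p \<partial>\<pi>) < e"
      have "\<exists>Z\<in>borel_measurable M. distr M borel Z = distr ?\<pi> borel fst \<and>
          (\<integral>\<^sup>+q. ?c (Z q, rep Z1 q) \<partial>M) < e"
      proof (rule ex_near_optimal[OF _ _ _ _ cont' _ a2 a1])
        show "prob_space ?\<pi>" by (rule \<pi>.prob_space_distr) measurable
        show "distr ?\<pi> borel snd = distr M borel (rep Z1)" unfolding m' by (simp add: law_def)
        show "?c (y, x) \<le> a2 y + a1 x" for x y using c_le[of x y] by (simp add: add.commute)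
        show "(\<integral>\<^sup>+p. a2 (fst p) \<partial>?\<pi>) < \<infinity>" using fin(2) by (subst nn_integral_distr) auto
        show "(\<integral>\<^sup>+p. a1 (snd p) \<partial>?\<pi>) < \<infinity>" using fin(1) by (subst nn_integral_distr) auto
        show "(\<integral>\<^sup>+p. ?c p \<partial>?\<pi>) < e" using e by (subst nn_integral_distr) auto
      qed simp_all
      then obtain Z where Z: "Z \<in> borel_measurable M" "distr M borel Z = \<mu>"
        "(\<integral>\<^sup>+q. c (rep Z1 q, Z q) \<partial>M) < e" unfolding m' by auto
      let ?Z = "ae_eq M `` {Z}"
      have L: "?Z \<in> L0 M" "Z \<in> ?Z" using class_in_L0[OF Z(1)] by auto
      have law: "law M ?Z = \<mu>" using law_class[OF Z(1)] Z(2) by simp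
      have X: "?Z \<in> X2" using law_in_Prob_fin_iff[OF L(1) a2] law \<mu> by simp
      have "?I \<le> Ch Z1 ?Z" using X law by (intro INF_lower) simp
      also have "\<dots> = (\<integral>\<^sup>+q. c (rep Z1 q, Z q) \<partial>M)"
        by (intro lifted_cost_eq L rep_in) fact+
      finally show "?I \<le> e" using Z(3) by simp
    qed
  qed
qed

text \<open>A lifted function is constant on the random variables of a given law; this shifted form
  serves with \<open>r\<close> its value there, or with a constant \<alpha> from a concave
  representation.\<close>

lemma INF_lifted_left_minus:
  assumes "Z2 \<in> X2" "\<mu> \<in> P1" "r \<noteq> \<infinity>"
  shows "(INF Z1\<in>{Z1\<in>X1. law M Z1 = \<mu>}. enn2ereal (Ch Z1 Z2) - r) = enn2ereal (C \<mu> (law M Z2)) - r"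
  using ex_L0_fin_law[OF a1 assms(2)]
  by (subst INF_enn2ereal_minus) (auto simp: assms INF_lifted_left)

lemma INF_lifted_right_minus:
  assumes "Z1 \<in> X1" "\<mu> \<in> P2" "r \<noteq> \<infinity>"
  shows "(INF Z2\<in>{Z2\<in>X2. law M Z2 = \<mu>}. enn2ereal (Ch Z1 Z2) - r) = enn2ereal (C (law M Z1) \<mu>) - r"
  using ex_L0_fin_law[OF a2 assms(2)]
  by (subst INF_enn2ereal_minus) (auto simp: assms INF_lifted_right)

lemma transport_cost_le_lifted_minus:
  assumes "Z1 \<in> X1" "Z2 \<in> X2"
  shows "enn2ereal (C (law M Z1) (law M Z2)) - r \<le> enn2ereal (Ch Z1 Z2) - r"
  using transport_cost_le_lifted[OF L0_fin_subset L0_fin_subset, OF assms]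
  by (intro ereal_minus_mono) (auto simp: less_eq_ennreal.rep_eq[symmetric])

end

text \<open>Elements of the product are extensional, hence \<open>undefined\<close> off
  \<open>I\<close>. The identity thus embeds the product measurably into the full function space,
  which is a Polish type when the factor is, so that \<open>realise_law\<close> becomes
  applicable.\<close>

lemma measurable_extend_PiM:
  fixes I :: "'i::countable set"
  shows "(\<lambda>x. x) \<in> (\<Pi>\<^sub>M n\<in>I. (borel :: 'x::second_countable_topology measure)) \<rightarrow>\<^sub>M borel"
proof -
  have "(\<lambda>x. x) \<in> (\<Pi>\<^sub>M n\<in>I. (borel :: 'x measure)) \<rightarrow>\<^sub>M (\<Pi>\<^sub>M n\<in>UNIV. borel)"
  proof (rule measurable_PiM_single')
    fix i :: 'i
    show "(\<lambda>x. x i) \<in> (\<Pi>\<^sub>M n\<in>I. (borel :: 'x measure)) \<rightarrow>\<^sub>M borel"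
    proof (cases "i \<in> I")
      case False
      have "(\<lambda>x. undefined) \<in> (\<Pi>\<^sub>M n\<in>I. (borel :: 'x measure)) \<rightarrow>\<^sub>M borel" by simp
      then show ?thesis
        by (subst measurable_cong[where g="\<lambda>_. undefined"])
          (use False in \<open>auto simp: space_PiM PiE_def extensional_def\<close>)
    qed (rule measurable_component_singleton)
  qed simp
  then show ?thesis by (simp only: measurable_cong_sets[OF refl sets_PiM_equal_borel])
qed

section \<open>Lifting conjugates, concavity, superdifferentials and monotonicity\<close>

context lifted_transport
begin

text \<open>The infimum over \<open>X1\<close> is taken law by law: among all \<open>Z1\<close> of
  law \<mu> the value of \<phi> is fixed and the infimum of the lifted costs is the transport
  cost.\<close>

lemma lift_conjugate:
  assumes lt: "\<And>\<mu>. \<mu> \<in> P1 \<Longrightarrow> \<phi> \<mu> < \<infinity>" and Z2: "Z2 \<in> X2"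
  shows "lift_fun M (cost_conjugate P1 C \<phi>) Z2 = cost_conjugate X1 Ch (lift_fun M \<phi>) Z2"
  unfolding lift_fun_def cost_conjugate_def comp_def
proof (rule antisym)
  show "(INF \<mu>\<in>P1. enn2ereal (C \<mu> (law M Z2)) - \<phi> \<mu>) \<le> (INF Z1\<in>X1. enn2ereal (Ch Z1 Z2) - \<phi> (law M Z1))"
  proof (rule INF_greatest)
    fix Z1 assume "Z1 \<in> X1"
    then show "(INF \<mu>\<in>P1. enn2ereal (C \<mu> (law M Z2)) - \<phi> \<mu>) \<le> enn2ereal (Ch Z1 Z2) - \<phi> (law M Z1)"
      using law_in_Prob_fin[OF a1] transport_cost_le_lifted_minus[OF _ Z2]
      by (intro INF_lower2[of "law M Z1"])
  qed
  show "(INF Z1\<in>X1. enn2ereal (Ch Z1 Z2) - \<phi> (law M Z1)) \<le> (INF \<mu>\<in>P1. enn2ereal (C \<mu> (law M Z2)) - \<phi> \<mu>)"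
  proof (rule INF_greatest)
    fix \<mu> assume \<mu>: "\<mu> \<in> P1"
    have "(INF Z1\<in>X1. enn2ereal (Ch Z1 Z2) - \<phi> (law M Z1))
        \<le> (INF Z1\<in>{Z1\<in>X1. law M Z1 = \<mu>}. enn2ereal (Ch Z1 Z2) - \<phi> \<mu>)"
      by (rule INF_greatest) (auto intro: INF_lower)
    also have "\<dots> = enn2ereal (C \<mu> (law M Z2)) - \<phi> \<mu>"
      using lt[OF \<mu>] by (intro INF_lifted_left_minus Z2 \<mu>) auto
    finally show "(INF Z1\<in>X1. enn2ereal (Ch Z1 Z2) - \<phi> (law M Z1)) \<le> enn2ereal (C \<mu> (law M Z2)) - \<phi> \<mu>" .
  qed
qed

lemma lift_concave:
  "cost_concave P1 P2 C \<phi> \<longleftrightarrow> cost_concave X1 X2 Ch (lift_fun M \<phi>)"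
proof
  assume *: "cost_concave P1 P2 C \<phi>"
  then obtain A where A: "A \<subseteq> P2 \<times> UNIV"
    and rep: "\<And>\<mu>. \<mu> \<in> P1 \<Longrightarrow> \<phi> \<mu> = (INF (y2, \<alpha>)\<in>A. enn2ereal (C \<mu> y2) - ereal \<alpha>)"
    unfolding cost_concave_def by blast
  define Ah where "Ah = {(Z2, \<alpha>). Z2 \<in> X2 \<and> (law M Z2, \<alpha>) \<in> A}"
  have "lift_fun M \<phi> Z1 = (INF (Z2, \<alpha>)\<in>Ah. enn2ereal (Ch Z1 Z2) - ereal \<alpha>)" if Z1: "Z1 \<in> X1" for Z1
  proof -
    have "\<phi> (law M Z1) = (INF (y2, \<alpha>)\<in>A. enn2ereal (C (law M Z1) y2) - ereal \<alpha>)"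
      using rep law_in_Prob_fin[OF a1 Z1] by blast
    also have "\<dots> = (INF (Z2, \<alpha>)\<in>Ah. enn2ereal (Ch Z1 Z2) - ereal \<alpha>)" (is "?l = ?r")
    proof (rule antisym)
      show "?l \<le> ?r"
      proof (rule INF_greatest, clarify)
        fix Z2 \<alpha> assume "(Z2, \<alpha>) \<in> Ah"
        then have "Z2 \<in> X2" "(law M Z2, \<alpha>) \<in> A" by (auto simp: Ah_def)
        then show "?l \<le> enn2ereal (Ch Z1 Z2) - ereal \<alpha>"
          using transport_cost_le_lifted_minus[OF Z1]
          by (intro INF_lower2[of "(law M Z2, \<alpha>)"]) auto
      qed
      show "?r \<le> ?l"
      proof (rule INF_greatest, clarify)
        fix \<mu> \<alpha> assume \<mu>: "(\<mu>, \<alpha>) \<in> A"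
        then have "\<mu> \<in> P2" using A by auto
        have "?r \<le> (INF Z2\<in>{Z2\<in>X2. law M Z2 = \<mu>}. enn2ereal (Ch Z1 Z2) - ereal \<alpha>)"
        proof (rule INF_greatest)
          fix Z2 assume "Z2 \<in> {Z2\<in>X2. law M Z2 = \<mu>}"
          then show "?r \<le> enn2ereal (Ch Z1 Z2) - ereal \<alpha>"
            using \<mu> by (intro INF_lower2[of "(Z2, \<alpha>)"]) (auto simp: Ah_def)
        qed
        also have "\<dots> = enn2ereal (C (law M Z1) \<mu>) - ereal \<alpha>"
          by (rule INF_lifted_right_minus[OF Z1 \<open>\<mu> \<in> P2\<close>]) simp
        finally show "?r \<le> enn2ereal (C (law M Z1) \<mu>) - ereal \<alpha>" .
      qed
    qed
    finally show ?thesis by (simp add: lift_fun_def)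
  qed
  moreover have "\<exists>Z1\<in>X1. lift_fun M \<phi> Z1 \<noteq> -\<infinity>"
    using * ex_L0_fin_law[OF a1] unfolding cost_concave_def lift_fun_def by (metis comp_apply)
  moreover have "\<forall>Z1\<in>X1. lift_fun M \<phi> Z1 < \<infinity>"
    using * law_in_Prob_fin[OF a1] unfolding cost_concave_def lift_fun_def by auto
  moreover have "Ah \<subseteq> X2 \<times> UNIV" by (auto simp: Ah_def)
  ultimately show "cost_concave X1 X2 Ch (lift_fun M \<phi>)" unfolding cost_concave_def by blast
next
  assume *: "cost_concave X1 X2 Ch (lift_fun M \<phi>)"
  then obtain Ah where Ah: "Ah \<subseteq> X2 \<times> UNIV"
    and rep: "\<And>Z1. Z1 \<in> X1 \<Longrightarrow> \<phi> (law M Z1) = (INF (Z2, \<alpha>)\<in>Ah. enn2ereal (Ch Z1 Z2) - ereal \<alpha>)"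
    unfolding cost_concave_def lift_fun_def by auto
  \<comment> \<open>Passing from \<open>Z2\<close> to its law could lower the infimum, since
    \<open>C\<close> lies below \<open>Ch\<close>. Law invariance prevents this: the bound by
    \<open>Ch Z1 Z2\<close> holds for every \<open>Z1\<close> of law \<mu> with the same left-hand
    side, and the infimum over these \<open>Z1\<close> is \<open>C\<close>.\<close>
  define A where "A = (\<lambda>(Z2, \<alpha>). (law M Z2, \<alpha>)) ` Ah"
  have "\<phi> \<mu> = (INF (y2, \<alpha>)\<in>A. enn2ereal (C \<mu> y2) - ereal \<alpha>)" (is "_ = ?r") if \<mu>: "\<mu> \<in> P1" for \<mu>
  proof (rule antisym)
    show "\<phi> \<mu> \<le> ?r"
    proof (rule INF_greatest, clarify)
      fix y2 \<alpha> assume "(y2, \<alpha>) \<in> A"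
      then obtain Z2 where Z2: "(Z2, \<alpha>) \<in> Ah" "y2 = law M Z2" by (auto simp: A_def)
      then have "Z2 \<in> X2" using Ah by auto
      have "\<phi> \<mu> \<le> (INF Z1\<in>{Z1\<in>X1. law M Z1 = \<mu>}. enn2ereal (Ch Z1 Z2) - ereal \<alpha>)"
      proof (rule INF_greatest)
        fix Z1 assume "Z1 \<in> {Z1\<in>X1. law M Z1 = \<mu>}"
        then have "\<phi> \<mu> = (INF (Z2, \<alpha>)\<in>Ah. enn2ereal (Ch Z1 Z2) - ereal \<alpha>)"
          using rep by auto
        also have "\<dots> \<le> enn2ereal (Ch Z1 Z2) - ereal \<alpha>"
          using Z2(1) by (rule INF_lower2) simp
        finally show "\<phi> \<mu> \<le> enn2ereal (Ch Z1 Z2) - ereal \<alpha>" .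
      qed
      also have "\<dots> = enn2ereal (C \<mu> (law M Z2)) - ereal \<alpha>"
        by (rule INF_lifted_left_minus[OF \<open>Z2 \<in> X2\<close> \<mu>]) simp
      finally show "\<phi> \<mu> \<le> enn2ereal (C \<mu> y2) - ereal \<alpha>" by (simp add: Z2)
    qed
    obtain Z1 where Z1: "Z1 \<in> X1" "law M Z1 = \<mu>" using ex_L0_fin_law[OF a1 \<mu>] by blast
    have "?r \<le> (INF (Z2, \<alpha>)\<in>Ah. enn2ereal (Ch Z1 Z2) - ereal \<alpha>)"
    proof (rule INF_greatest, clarify)
      fix Z2 \<alpha> assume Z2: "(Z2, \<alpha>) \<in> Ah"
      then have "(law M Z2, \<alpha>) \<in> A" by (force simp: A_def)
      moreover have "Z2 \<in> X2" using Z2 Ah by auto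
      ultimately show "?r \<le> enn2ereal (Ch Z1 Z2) - ereal \<alpha>"
        using transport_cost_le_lifted_minus[OF Z1(1), of Z2] Z1(2)
        by (intro INF_lower2[of "(law M Z2, \<alpha>)"]) auto
    qed
    then show "?r \<le> \<phi> \<mu>" using rep[OF Z1(1)] Z1(2) by simp
  qed
  moreover have "\<exists>\<mu>\<in>P1. \<phi> \<mu> \<noteq> -\<infinity>"
    using * law_in_Prob_fin[OF a1] unfolding cost_concave_def lift_fun_def by auto
  moreover have "\<forall>\<mu>\<in>P1. \<phi> \<mu> < \<infinity>"
    using * ex_L0_fin_law[OF a1] unfolding cost_concave_def lift_fun_def by (metis comp_apply)
  moreover have "A \<subseteq> P2 \<times> UNIV" using Ah law_in_Prob_fin[OF a2] by (auto simp: A_def)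
  ultimately show "cost_concave P1 P2 C \<phi>" unfolding cost_concave_def by blast
qed

text \<open>Testing minimality against all competitors of a given law \<mu> replaces their lifted
  costs by a transport cost. The competitor law \<open>law M Z1\<close> itself forces the pair to be
  optimal.\<close>

lemma lift_superdifferential:
  assumes lt: "\<And>\<mu>. \<mu> \<in> P1 \<Longrightarrow> \<phi> \<mu> < \<infinity>" and L: "Z1 \<in> L0 M" "Z2 \<in> L0 M"
  shows "(Z1, Z2) \<in> superdifferential X1 X2 Ch (lift_fun M \<phi>) \<longleftrightarrow>
    (law M Z1, law M Z2) \<in> superdifferential P1 P2 C \<phi> \<and> Ch Z1 Z2 = C (law M Z1) (law M Z2)"
proof safe
  assume *: "(Z1, Z2) \<in> superdifferential X1 X2 Ch (lift_fun M \<phi>)"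
  then have Z: "Z1 \<in> X1" "Z2 \<in> X2" and gt: "\<phi> (law M Z1) > -\<infinity>"
    and sup: "\<And>Z1'. Z1' \<in> X1 \<Longrightarrow>
      enn2ereal (Ch Z1 Z2) - \<phi> (law M Z1) \<le> enn2ereal (Ch Z1' Z2) - \<phi> (law M Z1')"
    by (auto simp: superdifferential_def lift_fun_def)
  have P: "law M Z1 \<in> P1" "law M Z2 \<in> P2" using Z law_in_Prob_fin a1 a2 by blast+
  have le: "enn2ereal (Ch Z1 Z2) - \<phi> (law M Z1) \<le> enn2ereal (C \<mu> (law M Z2)) - \<phi> \<mu>"
    if \<mu>: "\<mu> \<in> P1" for \<mu>
  proof -
    have "enn2ereal (Ch Z1 Z2) - \<phi> (law M Z1) \<le> (INF Z1\<in>{Z1\<in>X1. law M Z1 = \<mu>}. enn2ereal (Ch Z1 Z2) - \<phi> \<mu>)"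
      using sup by (intro INF_greatest) auto
    also have "\<dots> = enn2ereal (C \<mu> (law M Z2)) - \<phi> \<mu>"
      using lt[OF \<mu>] by (intro INF_lifted_left_minus Z \<mu>) auto
    finally show ?thesis .
  qed
  \<comment> \<open>The inequality \<open>le\<close> at \<open>law M Z1\<close> has the same finite
    \<phi>-value on both sides; cancelling it leaves optimality.\<close>
  have "\<bar>\<phi> (law M Z1)\<bar> \<noteq> \<infinity>" using gt lt[OF P(1)] by auto
  with le[OF P(1)] have "enn2ereal (Ch Z1 Z2) \<le> enn2ereal (C (law M Z1) (law M Z2))"
    by (cases "\<phi> (law M Z1)"; cases "enn2ereal (Ch Z1 Z2)"; cases "enn2ereal (C (law M Z1) (law M Z2))") auto
  then show eq: "Ch Z1 Z2 = C (law M Z1) (law M Z2)"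
    using transport_cost_le_lifted[OF L] by (simp add: antisym less_eq_ennreal.rep_eq[symmetric])
  show "(law M Z1, law M Z2) \<in> superdifferential P1 P2 C \<phi>"
    using P gt le by (simp add: superdifferential_def eq)
next
  assume *: "(law M Z1, law M Z2) \<in> superdifferential P1 P2 C \<phi>"
    and eq: "Ch Z1 Z2 = C (law M Z1) (law M Z2)"
  then have P: "law M Z1 \<in> P1" "law M Z2 \<in> P2" and gt: "\<phi> (law M Z1) > -\<infinity>"
    and sup: "\<And>\<mu>. \<mu> \<in> P1 \<Longrightarrow> enn2ereal (Ch Z1 Z2) - \<phi> (law M Z1) \<le> enn2ereal (C \<mu> (law M Z2)) - \<phi> \<mu>"
    by (auto simp: superdifferential_def)
  have Z: "Z1 \<in> X1" "Z2 \<in> X2" using P law_in_Prob_fin_iff L a1 a2 by blast+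
  have "enn2ereal (Ch Z1 Z2) - \<phi> (law M Z1) \<le> enn2ereal (Ch Z1' Z2) - \<phi> (law M Z1')" if "Z1' \<in> X1" for Z1'
    using sup[OF law_in_Prob_fin[OF a1 that]] transport_cost_le_lifted_minus[OF that Z(2)]
    by (rule order_trans)
  then show "(Z1, Z2) \<in> superdifferential X1 X2 Ch (lift_fun M \<phi>)"
    using Z gt by (simp add: superdifferential_def lift_fun_def)
qed

lemma lift_set_subset: "F \<subseteq> Prob_fin2 a1 a2 \<Longrightarrow> lift_set M F \<subseteq> X1 \<times> X2"
proof (rule subsetI)
  fix Z assume "F \<subseteq> Prob_fin2 a1 a2" "Z \<in> lift_set M F"
  then have Z: "fst Z \<in> L0 M" "snd Z \<in> L0 M" "joint_law M (fst Z) (snd Z) \<in> Prob_fin2 a1 a2"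
    by (auto simp: lift_set_def)
  then show "Z \<in> X1 \<times> X2"
    using joint_law_in_Prob_fin2_iff[OF Z(1,2) a1 a2] by (simp add: mem_Times_iff)
qed

text \<open>Finite families of pairs of random variables have a joint law \<theta> on the product,
  and every \<theta> arises in this way by realisation. The marginals and all permuted costs depend
  on \<theta> alone, so the two conditions test the same inequalities.\<close>

lemma lift_cyclically_monotone:
  assumes F: "F \<subseteq> Prob_fin2 a1 a2"
  shows "totally_cyclically_monotone a1 a2 c F \<longleftrightarrow> cyclically_monotone X1 X2 Ch (lift_set M F)"
proof
  assume total: "totally_cyclically_monotone a1 a2 c F"
  show "cyclically_monotone X1 X2 Ch (lift_set M F)"
    unfolding cyclically_monotone_def
  proof (intro conjI allI impI lift_set_subset F)
    fix k :: nat and y1 y2 \<sigma>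
    assume k: "1 \<le> k" and G: "\<forall>i\<in>{1..k}. (y1 i, y2 i) \<in> lift_set M F" and \<sigma>: "\<sigma> permutes {1..k}"
    have L: "y1 i \<in> L0 M" "y2 i \<in> L0 M" "joint_law M (y1 i) (y2 i) \<in> F" if "i \<in> {1..k}" for i
      using G that by (auto simp: lift_set_def)
    have \<sigma>k: "\<sigma> i \<in> {1..k}" if "i \<in> {1..k}" for i using permutes_in_image[OF \<sigma>] that by blast
    define V where "V q = (\<lambda>i\<in>{1..k}. (rep (y1 i) q, rep (y2 i) q))" for q
    let ?P = "\<Pi>\<^sub>M n\<in>{1..k}. (borel :: ('a \<times> 'b) measure)"
    have V[measurable]: "V \<in> M \<rightarrow>\<^sub>M ?P"
      unfolding V_def
      by (rule measurable_restrict) (auto intro!: borel_measurable_Pair rep_measurable L)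
    have comp[measurable]: "(\<lambda>x. x i) \<in> ?P \<rightarrow>\<^sub>M borel" if "i \<in> {1..k}" for i
      using that by (rule measurable_component_singleton)
    define \<theta> where "\<theta> = distr M ?P V"
    have "\<theta> \<in> space (prob_algebra ?P)"
      unfolding \<theta>_def space_prob_algebra using prob_space_distr[OF V] by simp
    moreover have "distr \<theta> borel (\<lambda>x. x n) \<in> F" if "n \<in> {1..k}" for n
    proof -
      have "distr \<theta> borel (\<lambda>x. x n) = joint_law M (y1 n) (y2 n)"
        unfolding \<theta>_def joint_law_def
        by (subst distr_distr[OF comp[OF that] V]) (use that in \<open>simp add: comp_def V_def\<close>)
      then show ?thesis using L that by simp
    qed
    ultimately have ineq: "(\<integral>\<^sup>+x. (\<Sum>i=1..k. c (fst (x i), snd (x i))) \<partial>\<theta>)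
        \<le> (\<integral>\<^sup>+x. (\<Sum>i=1..k. c (fst (x i), snd (x (\<sigma> i)))) \<partial>\<theta>)"
      using total k \<sigma> unfolding totally_cyclically_monotone_def by blast
    \<comment> \<open>The identity gives one side of the inequality and \<sigma> the other. The
      indices must stay in \<open>{1..k}\<close>, as \<open>V q\<close> is \<open>undefined\<close>
      elsewhere.\<close>
    have eq: "(\<integral>\<^sup>+x. (\<Sum>i=1..k. c (fst (x i), snd (x (\<tau> i)))) \<partial>\<theta>) = (\<Sum>i=1..k. Ch (y1 i) (y2 (\<tau> i)))"
      if \<tau>: "\<And>i. i \<in> {1..k} \<Longrightarrow> \<tau> i \<in> {1..k}" for \<tau>
    proof -
      have m: "(\<lambda>x. c (fst (x i), snd (x (\<tau> i)))) \<in> borel_measurable ?P" if "i \<in> {1..k}" for i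
        by (intro measurable_compose[OF borel_measurable_Pair c_measurable]
            measurable_compose[OF comp borel_measurable_fst]
            measurable_compose[OF comp borel_measurable_snd] that \<tau>)
      have "(\<integral>\<^sup>+x. (\<Sum>i=1..k. c (fst (x i), snd (x (\<tau> i)))) \<partial>\<theta>)
          = (\<Sum>i=1..k. \<integral>\<^sup>+x. c (fst (x i), snd (x (\<tau> i))) \<partial>\<theta>)"
        by (rule nn_integral_sum) (use m in \<open>simp add: \<theta>_def\<close>)
      also have "\<dots> = (\<Sum>i=1..k. Ch (y1 i) (y2 (\<tau> i)))"
      proof (rule sum.cong[OF refl])
        fix i assume i: "i \<in> {1..k}"
        have "(\<integral>\<^sup>+x. c (fst (x i), snd (x (\<tau> i))) \<partial>\<theta>) = (\<integral>\<^sup>+q. c (fst (V q i), snd (V q (\<tau> i))) \<partial>M)"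
          unfolding \<theta>_def by (rule nn_integral_distr[OF V]) (use m[OF i] in simp)
        also have "\<dots> = Ch (y1 i) (y2 (\<tau> i))"
          unfolding lifted_cost_def using i \<tau>[OF i] by (simp add: V_def)
        finally show "(\<integral>\<^sup>+x. c (fst (x i), snd (x (\<tau> i))) \<partial>\<theta>) = Ch (y1 i) (y2 (\<tau> i))" .
      qed
      finally show ?thesis .
    qed
    show "(\<Sum>i=1..k. Ch (y1 i) (y2 i)) \<le> (\<Sum>i=1..k. Ch (y1 i) (y2 (\<sigma> i)))"
      using ineq eq[of "\<lambda>i. i"] eq[of \<sigma>] \<sigma>k by simp
  qed
next
  assume cyc: "cyclically_monotone X1 X2 Ch (lift_set M F)"
  show "totally_cyclically_monotone a1 a2 c F"
    unfolding totally_cyclically_monotone_def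
  proof (intro conjI allI ballI impI F)
    fix N :: nat and \<theta> and \<sigma> :: "nat \<Rightarrow> nat"
    let ?P = "\<Pi>\<^sub>M n\<in>{1..N}. (borel :: ('a \<times> 'b) measure)"
    assume N: "1 \<le> N" and \<theta>: "\<theta> \<in> space (prob_algebra ?P)"
      and \<theta>F: "\<forall>n\<in>{1..N}. distr \<theta> borel (\<lambda>x. x n) \<in> F" and \<sigma>: "\<sigma> permutes {1..N}"
    have \<sigma>N: "\<sigma> i \<in> {1..N}" if "i \<in> {1..N}" for i using permutes_in_image[OF \<sigma>] that by blast
    have s\<theta>: "sets \<theta> = sets ?P" and "prob_space \<theta>" using \<theta> by (auto simp: space_prob_algebra)
    interpret \<theta>: prob_space \<theta> by fact
    \<comment> \<open>This moves \<theta> to a Borel measure on the full function space, from which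
      \<open>realise_law\<close> yields one variable \<open>W\<close> carrying all
      coordinates.\<close>
    have ext: "(\<lambda>x. x) \<in> \<theta> \<rightarrow>\<^sub>M borel"
      using measurable_extend_PiM[where I="{1..N}"] by (simp only: measurable_cong_sets[OF s\<theta> refl])
    have comp: "(\<lambda>x. x i) \<in> (borel :: (nat \<Rightarrow> 'a \<times> 'b) measure) \<rightarrow>\<^sub>M borel" for i
      by (intro borel_measurable_continuous_onI continuous_on_product_coordinates)
    define \<theta>' :: "(nat \<Rightarrow> 'a \<times> 'b) measure" where "\<theta>' = distr \<theta> borel (\<lambda>x. x)"
    have "prob_space \<theta>'" "sets \<theta>' = sets borel"
      unfolding \<theta>'_def using \<theta>.prob_space_distr[OF ext] by auto
    then obtain W where W[measurable]: "W \<in> borel_measurable M" and dW: "distr M borel W = \<theta>'"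
      using realise_law by blast
    have Wi: "(\<lambda>q. W q i) \<in> borel_measurable M" for i
      using measurable_compose[OF W comp] .
    have W1: "(\<lambda>q. fst (W q i)) \<in> borel_measurable M" and W2: "(\<lambda>q. snd (W q i)) \<in> borel_measurable M" for i
      using measurable_compose[OF Wi] borel_measurable_fst borel_measurable_snd by blast+
    define y1 where "y1 i = ae_eq M `` {\<lambda>q. fst (W q i)}" for i
    define y2 where "y2 i = ae_eq M `` {\<lambda>q. snd (W q i)}" for i
    have L1: "y1 i \<in> L0 M \<and> (\<lambda>q. fst (W q i)) \<in> y1 i" for i
      unfolding y1_def by (rule class_in_L0[OF W1])
    have L2: "y2 i \<in> L0 M \<and> (\<lambda>q. snd (W q i)) \<in> y2 i" for i
      unfolding y2_def by (rule class_in_L0[OF W2])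
    have "(y1 i, y2 i) \<in> lift_set M F" if "i \<in> {1..N}" for i
    proof -
      have "joint_law M (y1 i) (y2 i) = distr M borel (\<lambda>q. W q i)"
        using joint_law_eq[of "y1 i" M "\<lambda>q. fst (W q i)" "y2 i" "\<lambda>q. snd (W q i)"] L1 L2 by simp
      also have "\<dots> = distr \<theta>' borel (\<lambda>x. x i)"
        unfolding dW[symmetric] by (subst distr_distr[OF comp W]) (simp add: comp_def)
      also have "\<dots> = distr \<theta> borel (\<lambda>x. x i)"
        unfolding \<theta>'_def by (subst distr_distr[OF comp ext]) (simp add: comp_def)
      finally show ?thesis using \<theta>F that L1 L2 by (simp add: lift_set_def)
    qed
    then have ineq: "(\<Sum>i=1..N. Ch (y1 i) (y2 i)) \<le> (\<Sum>i=1..N. Ch (y1 i) (y2 (\<sigma> i)))"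
      using cyc N \<sigma> unfolding cyclically_monotone_def by blast
    have m: "(\<lambda>x. c (fst (x i), snd (x j))) \<in> borel_measurable (borel :: (nat \<Rightarrow> 'a \<times> 'b) measure)" for i j
      by (intro measurable_compose[OF borel_measurable_Pair c_measurable]
          measurable_compose[OF comp borel_measurable_fst]
          measurable_compose[OF comp borel_measurable_snd])
    have eq1: "(\<integral>\<^sup>+x. c (fst (x i), snd (x j)) \<partial>\<theta>) = Ch (y1 i) (y2 j)" for i j
    proof -
      have "(\<integral>\<^sup>+x. c (fst (x i), snd (x j)) \<partial>\<theta>) = (\<integral>\<^sup>+x. c (fst (x i), snd (x j)) \<partial>\<theta>')"
        unfolding \<theta>'_def by (rule nn_integral_distr[OF ext, symmetric]) (use m in simp)
      also have "\<dots> = (\<integral>\<^sup>+q. c (fst (W q i), snd (W q j)) \<partial>M)"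
        unfolding dW[symmetric] by (rule nn_integral_distr[OF W]) (use m in simp)
      also have "\<dots> = Ch (y1 i) (y2 j)"
        using lifted_cost_eq[of "y1 i" M "\<lambda>q. fst (W q i)" "y2 j" "\<lambda>q. snd (W q j)"] L1 L2 by simp
      finally show ?thesis .
    qed
    have eq: "(\<integral>\<^sup>+x. (\<Sum>i=1..N. c (fst (x i), snd (x (\<tau> i)))) \<partial>\<theta>) = (\<Sum>i=1..N. Ch (y1 i) (y2 (\<tau> i)))" for \<tau>
      unfolding eq1[symmetric] by (rule nn_integral_sum) (rule measurable_compose[OF ext m])
    show "(\<integral>\<^sup>+x. (\<Sum>i=1..N. c (fst (x i), snd (x i))) \<partial>\<theta>)
        \<le> (\<integral>\<^sup>+x. (\<Sum>i=1..N. c (fst (x i), snd (x (\<sigma> i)))) \<partial>\<theta>)"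
      using ineq eq[of "\<lambda>i. i"] eq[of \<sigma>] by simp
  qed
qed

section \<open>The total superdifferential\<close>

lemma three_measurable:
  "(\<lambda>(x1, x2, x1'). (x1, x2)) \<in> (borel :: ('a \<times> 'b \<times> 'a) measure) \<rightarrow>\<^sub>M borel"
  "(\<lambda>(x1, x2, x1'). (x1', x2)) \<in> (borel :: ('a \<times> 'b \<times> 'a) measure) \<rightarrow>\<^sub>M borel"
  "(\<lambda>(x1, x2, x1'). x1) \<in> (borel :: ('a \<times> 'b \<times> 'a) measure) \<rightarrow>\<^sub>M borel"
  "(\<lambda>(x1, x2, x1'). x1') \<in> (borel :: ('a \<times> 'b \<times> 'a) measure) \<rightarrow>\<^sub>M borel"
  unfolding case_prod_beta by measurable

text \<open>The subtracted cost sees \<theta> only through \<pi>', a coupling of the competing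
  marginal with the second marginal of the given measure. Domination makes both costs finite, so the
  integral splits.\<close>

lemma integral_cost_diff:
  assumes \<theta>: "\<theta> \<in> (Prob :: ('a \<times> 'b \<times> 'a) measure set)"
    and \<pi>: "distr \<theta> borel (\<lambda>(x1, x2, x1'). (x1, x2)) \<in> Prob_fin2 a1 a2"
    and \<mu>: "distr \<theta> borel (\<lambda>(x1, x2, x1'). x1') \<in> P1"
  defines "\<pi>' \<equiv> distr \<theta> borel (\<lambda>(x1, x2, x1'). (x1', x2))"
  shows "(\<integral>(x1, x2, x1'). enn2real (c (x1, x2)) - enn2real (c (x1', x2)) \<partial>\<theta>)
      = enn2real (\<integral>\<^sup>+p. c p \<partial>distr \<theta> borel (\<lambda>(x1, x2, x1'). (x1, x2))) - enn2real (\<integral>\<^sup>+p. c p \<partial>\<pi>')"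
    and "\<pi>' \<in> couplings (distr \<theta> borel (\<lambda>(x1, x2, x1'). x1'))
      (distr (distr \<theta> borel (\<lambda>(x1, x2, x1'). (x1, x2))) borel snd)"
    and "distr \<theta> borel (\<lambda>(x1, x2, x1'). x1) = distr (distr \<theta> borel (\<lambda>(x1, x2, x1'). (x1, x2))) borel fst"
proof -
  have [measurable_cong]: "sets \<theta> = sets borel" and ps: "prob_space \<theta>" using \<theta> by (auto simp: Prob_iff)
  note [measurable] = three_measurable
  let ?\<pi> = "distr \<theta> borel (\<lambda>(x1, x2, x1'). (x1, x2))"
  show cp: "\<pi>' \<in> couplings (distr \<theta> borel (\<lambda>(x1, x2, x1'). x1')) (distr ?\<pi> borel snd)"
    unfolding couplings_def \<pi>'_def
    using distr_in_Prob[OF ps, of "\<lambda>(x1, x2, x1'). (x1', x2)"]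
    by (simp add: distr_distr comp_def split_beta')
  show "distr \<theta> borel (\<lambda>(x1, x2, x1'). x1) = distr ?\<pi> borel fst"
    by (simp add: distr_distr comp_def split_beta')
  have \<pi>m: "distr ?\<pi> borel fst \<in> P1" "distr ?\<pi> borel snd \<in> P2" "?\<pi> \<in> Prob"
    using \<pi> by (auto simp: Prob_fin2_def)
  have fin': "(\<integral>\<^sup>+p. c p \<partial>\<pi>') < \<infinity>" by (rule coupling_cost_finite(3)[OF cp \<mu> \<pi>m(2)])
  have fin: "(\<integral>\<^sup>+p. c p \<partial>?\<pi>) < \<infinity>"
    by (rule coupling_cost_finite(3)[OF _ \<pi>m(1,2)]) (simp add: couplings_def \<pi>m(3))
  have e: "(\<integral>\<^sup>+p. c p \<partial>?\<pi>) = (\<integral>\<^sup>+t. c (fst t, fst (snd t)) \<partial>\<theta>)"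
    by (subst nn_integral_distr) (auto simp: case_prod_beta)
  have e': "(\<integral>\<^sup>+p. c p \<partial>\<pi>') = (\<integral>\<^sup>+t. c (snd (snd t), fst (snd t)) \<partial>\<theta>)"
    unfolding \<pi>'_def by (subst nn_integral_distr) (auto simp: case_prod_beta)
  show "(\<integral>(x1, x2, x1'). enn2real (c (x1, x2)) - enn2real (c (x1', x2)) \<partial>\<theta>)
      = enn2real (\<integral>\<^sup>+p. c p \<partial>?\<pi>) - enn2real (\<integral>\<^sup>+p. c p \<partial>\<pi>')"
    using fin fin' unfolding e e' case_prod_beta by (intro integral_enn2real_diff) measurable
qed

text \<open>A competitor \<open>Z\<close> becomes the third coordinate of the joint law of
  \<open>(Z1, Z2, Z)\<close>. The converse goes through the superdifferential of \<open>C\<close>,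
  which controls all couplings.\<close>

lemma lift_total_superdifferential:
  assumes lt: "\<And>\<mu>. \<mu> \<in> P1 \<Longrightarrow> \<phi> \<mu> < \<infinity>" and ex: "\<exists>\<mu>\<in>P1. \<phi> \<mu> \<noteq> -\<infinity>"
  shows "lift_set M (total_superdifferential a1 a2 c \<phi>) = superdifferential X1 X2 Ch (lift_fun M \<phi>)"
proof (rule set_eqI, clarify)
  fix Z1 Z2
  show "(Z1, Z2) \<in> lift_set M (total_superdifferential a1 a2 c \<phi>) \<longleftrightarrow>
    (Z1, Z2) \<in> superdifferential X1 X2 Ch (lift_fun M \<phi>)"
  proof
    assume "(Z1, Z2) \<in> lift_set M (total_superdifferential a1 a2 c \<phi>)"
    then have L: "Z1 \<in> L0 M" "Z2 \<in> L0 M"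
      and t: "joint_law M Z1 Z2 \<in> total_superdifferential a1 a2 c \<phi>" by (auto simp: lift_set_def)
    then have \<pi>: "joint_law M Z1 Z2 \<in> Prob_fin2 a1 a2" by (simp add: total_superdifferential_def)
    then have Z: "Z1 \<in> X1" "Z2 \<in> X2" using joint_law_in_Prob_fin2_iff[OF L a1 a2] by auto
    have ineq: "ereal (enn2real (Ch Z1 Z2) - enn2real (Ch Z Z2)) \<le> \<phi> (law M Z1) - \<phi> (law M Z)"
      if Z': "Z \<in> X1" for Z
    proof -
      have [measurable]: "Z \<in> L0 M" using Z' by (rule L0_fin_subset)
      note [measurable] = L three_measurable
      define \<theta> where "\<theta> = distr M borel (\<lambda>q. (rep Z1 q, rep Z2 q, rep Z q))"
      have \<theta>: "\<theta> \<in> Prob" unfolding \<theta>_def by (intro distr_in_Prob prob_space_axioms) measurable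
      have d12: "distr \<theta> borel (\<lambda>(x1, x2, x1'). (x1, x2)) = joint_law M Z1 Z2"
        unfolding \<theta>_def joint_law_def by (simp add: distr_distr comp_def)
      have d32: "distr \<theta> borel (\<lambda>(x1, x2, x1'). (x1', x2)) = joint_law M Z Z2"
        unfolding \<theta>_def joint_law_def by (simp add: distr_distr comp_def)
      have d1: "distr \<theta> borel (\<lambda>(x1, x2, x1'). x1) = law M Z1"
        unfolding \<theta>_def law_def by (simp add: distr_distr comp_def)
      have d3: "distr \<theta> borel (\<lambda>(x1, x2, x1'). x1') = law M Z"
        unfolding \<theta>_def law_def by (simp add: distr_distr comp_def)
      have P: "law M Z \<in> P1" using law_in_Prob_fin[OF a1 Z'] .
      have "ereal (\<integral>(x1, x2, x1'). enn2real (c (x1, x2)) - enn2real (c (x1', x2)) \<partial>\<theta>)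
          \<le> \<phi> (law M Z1) - \<phi> (law M Z)"
        using t \<theta> d12 d1 d3 P unfolding total_superdifferential_def by auto
      then show ?thesis
        using integral_cost_diff(1)[OF \<theta>] d12 d32 d3 P \<pi> lifted_cost_joint_law[OF L c_measurable]
          lifted_cost_joint_law[OF \<open>Z \<in> L0 M\<close> L(2) c_measurable] by simp
    qed
    \<comment> \<open>If \<phi> were -\<infinity> at \<open>law M Z1\<close>, a competitor with
      finite value would make the right-hand side of \<open>ineq\<close> equal to -\<infinity>,
      below a real number.\<close>
    have gt: "\<phi> (law M Z1) > -\<infinity>"
    proof -
      obtain Z where Z': "Z \<in> X1" "\<phi> (law M Z) \<noteq> -\<infinity>"
        using ex ex_L0_fin_law[OF a1] by metis
      with ineq[OF Z'(1)] lt[OF law_in_Prob_fin[OF a1 Z'(1)]] show ?thesis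
        by (cases "\<phi> (law M Z)"; cases "\<phi> (law M Z1)") auto
    qed
    have "enn2ereal (Ch Z1 Z2) - \<phi> (law M Z1) \<le> enn2ereal (Ch Z Z2) - \<phi> (law M Z)" if Z': "Z \<in> X1" for Z
    proof -
      obtain r s where "Ch Z1 Z2 = ennreal r" "Ch Z Z2 = ennreal s" "0 \<le> r" "0 \<le> s"
        using lifted_cost_finite[OF Z] lifted_cost_finite[OF Z' Z(2)]
        by (cases "Ch Z1 Z2"; cases "Ch Z Z2") auto
      then show ?thesis
        using ineq[OF Z'] gt lt[OF law_in_Prob_fin[OF a1 Z']] lt[OF law_in_Prob_fin[OF a1 Z(1)]]
        by (cases "\<phi> (law M Z)"; cases "\<phi> (law M Z1)") (auto simp: enn2ereal_ennreal)
    qed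
    then show "(Z1, Z2) \<in> superdifferential X1 X2 Ch (lift_fun M \<phi>)"
      using Z gt by (simp add: superdifferential_def lift_fun_def)
  next
    assume *: "(Z1, Z2) \<in> superdifferential X1 X2 Ch (lift_fun M \<phi>)"
    then have Z: "Z1 \<in> X1" "Z2 \<in> X2" by (auto simp: superdifferential_def)
    then have L: "Z1 \<in> L0 M" "Z2 \<in> L0 M" using L0_fin_subset by blast+
    have \<pi>: "joint_law M Z1 Z2 \<in> Prob_fin2 a1 a2" using joint_law_in_Prob_fin2_iff[OF L a1 a2] Z by simp
    have sd: "(law M Z1, law M Z2) \<in> superdifferential P1 P2 C \<phi>"
      and eq: "Ch Z1 Z2 = C (law M Z1) (law M Z2)"
      using * lift_superdifferential[OF lt L] by auto
    have "ereal (\<integral>(x1, x2, x1'). enn2real (c (x1, x2)) - enn2real (c (x1', x2)) \<partial>\<theta>)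
        \<le> \<phi> (distr \<theta> borel (\<lambda>(x1, x2, x1'). x1)) - \<phi> (distr \<theta> borel (\<lambda>(x1, x2, x1'). x1'))"
      if \<theta>: "\<theta> \<in> Prob" and d12: "distr \<theta> borel (\<lambda>(x1, x2, x1'). (x1, x2)) = joint_law M Z1 Z2"
        and d3: "distr \<theta> borel (\<lambda>(x1, x2, x1'). x1') \<in> P1" for \<theta> :: "('a \<times> 'b \<times> 'a) measure"
    proof -
      define \<mu> where "\<mu> = distr \<theta> borel (\<lambda>(x1, x2, x1'). x1')"
      define \<pi>' where "\<pi>' = distr \<theta> borel (\<lambda>(x1, x2, x1'). (x1', x2))"
      have \<mu>: "\<mu> \<in> P1" using d3 by (simp add: \<mu>_def)
      note icd = integral_cost_diff[OF \<theta> _ d3, unfolded d12, OF \<pi>, folded \<mu>_def \<pi>'_def,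
          unfolded joint_law_marginals[OF L]]
      \<comment> \<open>In general \<pi>' is not the law of a pair with second entry
        \<open>Z2\<close>, so minimality among lifted competitors says nothing about it directly; it
        enters as a coupling, through \<open>C\<close>.\<close>
      have le: "C \<mu> (law M Z2) \<le> (\<integral>\<^sup>+p. c p \<partial>\<pi>')"
        unfolding transport_cost_def by (rule INF_lower[OF icd(2)])
      have P: "law M Z1 \<in> P1" "law M Z2 \<in> P2" using Z law_in_Prob_fin a1 a2 by blast+
      have gt: "\<phi> (law M Z1) > -\<infinity>"
        and sup: "enn2ereal (C (law M Z1) (law M Z2)) - \<phi> (law M Z1) \<le> enn2ereal (C \<mu> (law M Z2)) - \<phi> \<mu>"
        using sd \<mu> by (auto simp: superdifferential_def)
      note sup
      also have "\<dots> \<le> enn2ereal (\<integral>\<^sup>+p. c p \<partial>\<pi>') - \<phi> \<mu>"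
        using le by (intro ereal_minus_mono) (auto simp: less_eq_ennreal.rep_eq)
      finally have main: "enn2ereal (Ch Z1 Z2) - \<phi> (law M Z1) \<le> enn2ereal (\<integral>\<^sup>+p. c p \<partial>\<pi>') - \<phi> \<mu>"
        by (simp add: eq)
      obtain r s where "Ch Z1 Z2 = ennreal r" "(\<integral>\<^sup>+p. c p \<partial>\<pi>') = ennreal s" "0 \<le> r" "0 \<le> s"
        using lifted_cost_finite[OF Z] coupling_cost_finite(3)[OF icd(2) \<mu> P(2)]
        by (cases "Ch Z1 Z2"; cases "\<integral>\<^sup>+p. c p \<partial>\<pi>'") auto
      then have "ereal (enn2real (Ch Z1 Z2) - enn2real (\<integral>\<^sup>+p. c p \<partial>\<pi>')) \<le> \<phi> (law M Z1) - \<phi> \<mu>"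
        using main gt lt[OF \<mu>] lt[OF P(1)]
        by (cases "\<phi> \<mu>"; cases "\<phi> (law M Z1)") (auto simp: enn2ereal_ennreal)
      then show ?thesis
        unfolding icd(1) icd(3) \<mu>_def[symmetric] lifted_cost_joint_law[OF L c_measurable] .
    qed
    then have "joint_law M Z1 Z2 \<in> total_superdifferential a1 a2 c \<phi>"
      using \<pi> by (auto simp: total_superdifferential_def)
    then show "(Z1, Z2) \<in> lift_set M (total_superdifferential a1 a2 c \<phi>)"
      using L by (simp add: lift_set_def)
  qed
qed

end

theorem proposition4p9:
  fixes M :: "'q measure"
    and a1 :: "'a::polish_space \<Rightarrow> ennreal"
    and a2 :: "'b::polish_space \<Rightarrow> ennreal"
    and c :: "'a \<times> 'b \<Rightarrow> ennreal"
    and \<phi>1 :: "'a measure \<Rightarrow> ereal"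
  assumes "prob_space M" and "standard_borel M" and "atomless M"
    and "a1 \<in> borel_measurable borel" and "a2 \<in> borel_measurable borel"
    and "continuous_on UNIV c"
    and "\<And>x1 x2. c (x1, x2) \<le> a1 x1 + a2 x2"
    and "\<And>\<mu>. \<mu> \<in> Prob_fin a1 \<Longrightarrow> \<phi>1 \<mu> < \<infinity>"
    and "\<exists>\<mu>\<in>Prob_fin a1. \<phi>1 \<mu> \<noteq> -\<infinity>"
  shows
    "(\<forall>Z2\<in>L0_fin M a2.
        lift_fun M (cost_conjugate (Prob_fin a1) (transport_cost c) \<phi>1) Z2
        = cost_conjugate (L0_fin M a1) (lifted_cost M c) (lift_fun M \<phi>1) Z2)
   \<and> (cost_concave (Prob_fin a1) (Prob_fin a2) (transport_cost c) \<phi>1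
        \<longleftrightarrow> cost_concave (L0_fin M a1) (L0_fin M a2) (lifted_cost M c) (lift_fun M \<phi>1))
   \<and> (\<forall>Z1\<in>L0 M. \<forall>Z2\<in>L0 M.
        (Z1, Z2) \<in> superdifferential (L0_fin M a1) (L0_fin M a2) (lifted_cost M c) (lift_fun M \<phi>1)
        \<longleftrightarrow> (law M Z1, law M Z2) \<in> superdifferential (Prob_fin a1) (Prob_fin a2) (transport_cost c) \<phi>1
            \<and> lifted_cost M c Z1 Z2 = transport_cost c (law M Z1) (law M Z2))
   \<and> (\<forall>F \<subseteq> Prob_fin2 a1 a2.
        totally_cyclically_monotone a1 a2 c F
        \<longleftrightarrow> cyclically_monotone (L0_fin M a1) (L0_fin M a2) (lifted_cost M c) (lift_set M F))
   \<and> lift_set M (total_superdifferential a1 a2 c \<phi>1)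
       = superdifferential (L0_fin M a1) (L0_fin M a2) (lifted_cost M c) (lift_fun M \<phi>1)"
proof -
  interpret diffuse_prob_space M by (rule diffuse_of_standard_borel) fact+
  interpret lifted_transport M a1 a2 c by unfold_locales fact+
  show ?thesis
  proof (intro conjI ballI allI impI)
    show "lift_set M (total_superdifferential a1 a2 c \<phi>1) = superdifferential X1 X2 Ch (lift_fun M \<phi>1)"
      by (rule lift_total_superdifferential[OF assms(8,9)])
  qed (rule lift_conjugate lift_concave lift_superdifferential lift_cyclically_monotone; (rule assms(8))?; assumption)+
qed

end
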